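(* Consider the hybrid architecture (the AC subgrid is a tree). Let $(\tilde{\mathbf V}^\star,\mathbf p^\star,\mathbf g_{\mathcal V}^\star,\mathbf d_{\mathcal V}^\star,\boldsymbol\lambda_{\mathcal V}^\star,\boldsymbol\mu^\star,\boldsymbol\Lambda_{\mathcal E}^\star)$ be an optimizer of the second-order cone (SOC) relaxation and its dual, i.e., the first four components are optimal in the SOC relaxation and the last three are optimal in its dual. If $$(\boldsymbol\lambda_{\mathcal V}^\star,\boldsymbol\mu^\star)\notin\bigcup_{k\in\mathcal E}\mathcal A_k,$$ then $\operatorname{rank}(\Xi_k(\tilde{\mathbf V}^\star))=1$ for all $k\in\mathcal E$, and the SOC relaxation is exact.
   Context: Notation: $\mathbb S^N$ is the set of Hermitian $N\times N$ matrices, $\mathbf X\succeq\mathbf 0$ means positive semidefinite (psd), $\mathbf e_n$ is a standard basis vector, $\mathbb R_+=[0,\infty)$; $\mathbf x_{\mathcal N}=(\mathbf x_n)_{n\in\mathcal N}$ denotes a tuple. Grid data. Buses $\mathcal V=\{1,\dots,N_V\}$, $N_V\ge2$, AC branches $\mathcal E=\{1,\dots,N_E\}$, DC branches $\mathcal D=\{1,\dots,N_D\}$; maps $\hat\epsilon,\check\epsilon:\mathcal E\to\mathcal V$ give source and destination of AC branches. The undirected graph on $\mathcal V$ with edges $\{\hat\epsilon(k),\check\epsilon(k)\}$, $k\in\mathcal E$, is a tree (in particular connected, no self-loops, no parallel or anti-parallel AC branches, $N_E=N_V-1$). Let $\mathcal I=\{(i,j)\in\mathcal V\times\mathcal V: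 i,j\in\{\hat\epsilon(k),\check\epsilon(k)\}\text{ for some }k\in\mathcal E\}$. For each $n\in\mathcal V$ there are given: $\mathbf P_n,\mathbf Q_n\in\mathbb S^{N_V}$ (active/reactive power), $\mathbf h_n\in\mathbb R^{N_D}$, $\mathbf M_n=\mathbf e_n\mathbf e_n^{T}$, voltage bounds $0<\underline V_n\le\bar V_n$, nonempty compact convex sets $\mathcal G_n,\mathcal D_n\subset\mathbb R^2$ (generation, load), a convex cost $C_n:\mathcal G_n\to\mathbb R$ and a concave benefit $B_n:\mathcal D_n\to\mathbb R$. For each $k\in\mathcal E$ there are given matrices in $\mathbb S^{N_V}$: current matrices $\hat{\mathbf I}_k,\check{\mathbf I}_k$ with current bounds $\hat J_k,\check J_k\ge0$, voltage drop matrices $\underline{\mathbf M}_k,\bar{\mathbf M}_k$, and angle difference matrices $\mathbf A_k,\underline{\mathbf A}_k,\bar{\mathbf A}_k$. All these Hermitian matrices have zero entries outside $\mathcal I$. DC flow bounds are $\underline{\mathbf p},\bar{\mathbf p}\in\mathbb R^{N_D}$. Let $M=2N_V+7N_E+2N_D$, $\mathcal M=\{1,\dots,M\}$, and let $(\mathbf C_m,\mathbf c_m,b_m)\in\mathbb S^{N_V}\times\mathbb R^{N_D}\times\mathbb R$, $m\in\mathcal M$, enumerate: $(\mathbf M_n,\mathbf 0,\bar V_n^2)$ and $(-\mathbf M_n,\mathbf 0,-\underline V_n^2)$ for $n\in\mathcal V$; $(\hat{\mathbf I}_k,\mathbf 0,\hat J_k^2)$, $(\check{\mathbf I}_k,\mathbf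 0,\check J_k^2)$ and $(\mathbf X,\mathbf 0,0)$ with $\mathbf X\in\{\underline{\mathbf M}_k,\bar{\mathbf M}_k,\mathbf A_k,\underline{\mathbf A}_k,\bar{\mathbf A}_k\}$ for $k\in\mathcal E$; $(\mathbf 0,\mathbf e_l,\bar p_l)$ and $(\mathbf 0,-\mathbf e_l,-\underline p_l)$ for $l\in\mathcal D$. Put $\mathbf b=[b_1,\dots,b_M]^T$. For $\mathbf W\in\mathbb S^{N_V}$, $\mathbf p\in\mathbb R^{N_D}$, $\mathbf g_n\in\mathcal G_n$, $\mathbf d_n\in\mathcal D_n$ ($n\in\mathcal V$), consider the constraints (PB) $\operatorname{tr}(\mathbf P_n\mathbf W)+\mathbf h_n^T\mathbf p=[\mathbf g_n-\mathbf d_n]_1$ and $\operatorname{tr}(\mathbf Q_n\mathbf W)=[\mathbf g_n-\mathbf d_n]_2$ for all $n\in\mathcal V$; (IN) $\operatorname{tr}(\mathbf C_m\mathbf W)+\mathbf c_m^T\mathbf p\le b_m$ for all $m\in\mathcal M$. The objective (welfare) is $\sum_{n}B_n(\mathbf d_n)-\sum_n C_n(\mathbf g_n)$. OPF problem: maximize the welfare over $\mathbf v\in\mathbb C^{N_V}$, $\mathbf p$, $\mathbf g_n\in\mathcal G_n$, $\mathbf d_n\in\mathcal D_n$ subject to (PB), (IN) with $\mathbf W=\mathbf v\mathbf v^{H}$. Standing assumption (strict feasibility): there is an OPF-feasible tuple $(\mathbf v,\mathbf p,\mathbf g_{\mathcal V},\mathbf d_{\mathcal V})$ for which all inequalities in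 (IN) hold strictly and $\mathbf g_n-\mathbf d_n\in\operatorname{int}(\mathcal G_n-\mathcal D_n)$ for all $n$, where $\mathcal G_n-\mathcal D_n=\{\mathbf g-\mathbf d:\mathbf g\in\mathcal G_n,\mathbf d\in\mathcal D_n\}$; moreover all $\mathcal G_n,\mathcal D_n$ are polyhedral. SOC relaxation: let $\tilde{\mathbb S}^{N_V}=\{\mathbf V\in\mathbb S^{N_V}:[\mathbf V]_{i,j}=0\ \forall (i,j)\notin\mathcal I\}$, $\mathbf S_k=[\mathbf e_{\hat\epsilon(k)},\mathbf e_{\check\epsilon(k)}]$, $\Xi_k(\tilde{\mathbf V})=\mathbf S_k^T\tilde{\mathbf V}\mathbf S_k\in\mathbb S^2$. Maximize the welfare over $\tilde{\mathbf V}\in\tilde{\mathbb S}^{N_V}$, $\mathbf p$, $\mathbf g_n\in\mathcal G_n$, $\mathbf d_n\in\mathcal D_n$ subject to (PB), (IN) with $\mathbf W=\tilde{\mathbf V}$ and $\Xi_k(\tilde{\mathbf V})\succeq\mathbf 0$ for all $k\in\mathcal E$. For $\boldsymbol\lambda_{\mathcal V}=(\boldsymbol\lambda_n)_{n\in\mathcal V}$, $\boldsymbol\lambda_n\in\mathbb R^2$, and $\boldsymbol\mu\in\mathbb R^M$ let $\Psi(\boldsymbol\lambda_{\mathcal V},\boldsymbol\mu)=\sum_n([\boldsymbol\lambda_n]_1\mathbf P_n+[\boldsymbol\lambda_n]_2\mathbf Q_n)+\sum_m[\boldsymbol\mu]_m\mathbf C_m$, $\psi(\boldsymbol\lambda_{\mathcal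 V},\boldsymbol\mu)=\sum_n[\boldsymbol\lambda_n]_1\mathbf h_n+\sum_m[\boldsymbol\mu]_m\mathbf c_m$, $\sigma_n(\boldsymbol\lambda_n)=\max_{\mathbf d\in\mathcal D_n}\{B_n(\mathbf d)-\boldsymbol\lambda_n^T\mathbf d\}$, $\pi_n(\boldsymbol\lambda_n)=\max_{\mathbf g\in\mathcal G_n}\{\boldsymbol\lambda_n^T\mathbf g-C_n(\mathbf g)\}$ (suprema if not attained). Dual of the SOC relaxation: minimize $\boldsymbol\mu^T\mathbf b+\sum_n\sigma_n(\boldsymbol\lambda_n)+\sum_n\pi_n(\boldsymbol\lambda_n)$ over $\boldsymbol\lambda_n\in\mathbb R^2$, $\boldsymbol\mu\in\mathbb R_+^M$, $\boldsymbol\Lambda_k\in\mathbb S^2$ ($k\in\mathcal E$) subject to $\Psi(\boldsymbol\lambda_{\mathcal V},\boldsymbol\mu)=\sum_{k}\mathbf S_k\boldsymbol\Lambda_k\mathbf S_k^T$, $\psi(\boldsymbol\lambda_{\mathcal V},\boldsymbol\mu)=\mathbf 0$, and $\boldsymbol\Lambda_k\succeq\mathbf 0$ for all $k\in\mathcal E$. For $k\in\mathcal E$: $\mathcal A_k=\{(\boldsymbol\lambda_{\mathcal V},\boldsymbol\mu):\boldsymbol\lambda_n\in\mathbb R^2,\ \boldsymbol\mu\in\mathbb R^M,\ [\Psi(\boldsymbol\lambda_{\mathcal V},\boldsymbol\mu)]_{\hat\epsilon(k),\check\epsilon(k)}=0\}$. (A dual optimal $\boldsymbol\lambda_{\mathcal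 V}^\star$ with $(\boldsymbol\lambda_{\mathcal V}^\star,\boldsymbol\mu^\star)\in\bigcup_k\mathcal A_k$ is called a pathological price profile.) The SOC relaxation is exact if it has an optimal solution whose $\tilde{\mathbf V}^\star$ permits a psd rank-1 completion, i.e., there is a psd rank-1 matrix $\mathbf V\in\mathbb S^{N_V}$ with $[\mathbf V]_{i,j}=[\tilde{\mathbf V}^\star]_{i,j}$ for all $(i,j)\in\mathcal I$. *)

theory Defs
  imports "HOL-Analysis.Analysis"
begin

section \<open>Hermitian and positive semidefinite matrices\<close>

definition hermitian :: "complex^'n^'n \<Rightarrow> bool" where
  "hermitian A \<longleftrightarrow> (\<forall>i j. A $ i $ j = cnj (A $ j $ i))"

definition psd :: "complex^'n^'n \<Rightarrow> bool" where
  "psd A \<longleftrightarrow> hermitian A \<and> (\<forall>x. 0 \<le> Re (\<Sum>i\<in>UNIV. cnj (x $ i) * (A *v x) $ i))"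

definition outer :: "complex^'n \<Rightarrow> complex^'n^'n" where
  "outer v = (\<chi> i j. v $ i * cnj (v $ j))"

text \<open>The trace of a product of two Hermitian matrices is real, so below its real part is
  used as the (real) value of the trace.\<close>

definition rtr :: "complex^'n^'n \<Rightarrow> complex^'n^'n \<Rightarrow> real" where
  "rtr A W = Re (trace (A ** W))"

lemma trace_hermitian_mult:
  assumes "hermitian A" "hermitian W"
  shows "trace (A ** W) = complex_of_real (rtr A W)"
proof -
  have A: "cnj (A $ i $ j) = A $ j $ i" for i j
    by (rule sym) (use assms(1) in \<open>unfold hermitian_def, blast\<close>)
  have W: "cnj (W $ i $ j) = W $ j $ i" for i j
    by (rule sym) (use assms(2) in \<open>unfold hermitian_def, blast\<close>)
  have "cnj (trace (A ** W)) = (\<Sum>i\<in>UNIV. \<Sum>k\<in>UNIV. W $ i $ k * A $ k $ i)"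
    by (simp add: trace_def matrix_matrix_mult_def A W mult.commute)
  also have "\<dots> = trace (W ** A)"
    by (simp add: trace_def matrix_matrix_mult_def)
  finally have "cnj (trace (A ** W)) = trace (A ** W)"
    by (simp only: trace_mul_sym[of W A])
  then show ?thesis
    unfolding rtr_def by (simp add: complex_eq_iff)
qed

section \<open>Trees\<close>

text \<open>The finite undirected graph on the type \<open>'v\<close> with one edge \<open>{s k, t k}\<close> for each
  element \<open>k\<close> of the type \<open>'e\<close>.\<close>

definition adjacent :: "('e \<Rightarrow> 'v) \<Rightarrow> ('e \<Rightarrow> 'v) \<Rightarrow> ('v \<times> 'v) set" where
  "adjacent s t = {(u, w). \<exists>k. {u, w} = {s k, t k}}"

definition graph_cycle :: "('e \<Rightarrow> 'v) \<Rightarrow> ('e \<Rightarrow> 'v) \<Rightarrow> 'v list \<Rightarrow> bool" where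
  "graph_cycle s t xs \<longleftrightarrow> 3 \<le> length xs \<and> distinct xs \<and>
     (\<forall>i<length xs. (xs ! i, xs ! (Suc i mod length xs)) \<in> adjacent s t)"

text \<open>The graph is simple (no self-loops, no parallel or anti-parallel edges), connected
  and acyclic.\<close>

definition is_tree :: "('e \<Rightarrow> 'v) \<Rightarrow> ('e \<Rightarrow> 'v) \<Rightarrow> bool" where
  "is_tree s t \<longleftrightarrow>
     (\<forall>k. s k \<noteq> t k) \<and> inj (\<lambda>k. {s k, t k}) \<and>
     (\<forall>u w. (u, w) \<in> (adjacent s t)\<^sup>*) \<and> (\<nexists>xs. graph_cycle s t xs)"

section \<open>Grid data\<close>

text \<open>
  The buses are the elements of the finite type \<open>'v\<close>, the AC branches those of the finite
  type \<open>'e\<close>, and the DC branches the numbers in \<open>{1..n_dc}\<close>; there may be none.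
  Vectors over the DC branches are functions on \<^typ>\<open>nat\<close> of which only the values on
  \<open>{1..n_dc}\<close> are ever used.
\<close>

record ('v::finite, 'e::finite) grid =
  n_dc :: nat
  src :: "'e \<Rightarrow> 'v"                     \<comment> \<open>\<open>\<epsilon>\<close> with a hat\<close>
  dst :: "'e \<Rightarrow> 'v"                     \<comment> \<open>\<open>\<epsilon>\<close> with a check\<close>
  P_mat :: "'v \<Rightarrow> complex^'v^'v"        \<comment> \<open>active power\<close>
  Q_mat :: "'v \<Rightarrow> complex^'v^'v"        \<comment> \<open>reactive power\<close>
  h_vec :: "'v \<Rightarrow> nat \<Rightarrow> real"
  V_lo :: "'v \<Rightarrow> real"
  V_hi :: "'v \<Rightarrow> real"
  gen :: "'v \<Rightarrow> (real^2) set"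
  load :: "'v \<Rightarrow> (real^2) set"
  cost :: "'v \<Rightarrow> real^2 \<Rightarrow> real"
  benefit :: "'v \<Rightarrow> real^2 \<Rightarrow> real"
  I_src :: "'e \<Rightarrow> complex^'v^'v"        \<comment> \<open>current at the source and destination\<close>
  I_dst :: "'e \<Rightarrow> complex^'v^'v"
  J_src :: "'e \<Rightarrow> real"
  J_dst :: "'e \<Rightarrow> real"
  M_lo :: "'e \<Rightarrow> complex^'v^'v"         \<comment> \<open>voltage drop\<close>
  M_hi :: "'e \<Rightarrow> complex^'v^'v"
  A_mat :: "'e \<Rightarrow> complex^'v^'v"        \<comment> \<open>angle difference\<close>
  A_lo :: "'e \<Rightarrow> complex^'v^'v"
  A_hi :: "'e \<Rightarrow> complex^'v^'v"
  p_lo :: "nat \<Rightarrow> real"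
  p_hi :: "nat \<Rightarrow> real"

definition idx :: "('v::finite, 'e::finite) grid \<Rightarrow> ('v \<times> 'v) set" where
  "idx N = {(i, j). \<exists>k. i \<in> {src N k, dst N k} \<and> j \<in> {src N k, dst N k}}"

definition herm_sparse :: "('v::finite, 'e::finite) grid \<Rightarrow> (complex^'v^'v) set" where
  "herm_sparse N = {V. hermitian V \<and> (\<forall>i j. (i, j) \<notin> idx N \<longrightarrow> V $ i $ j = 0)}"

definition dc_dot :: "('v::finite, 'e::finite) grid \<Rightarrow> (nat \<Rightarrow> real) \<Rightarrow> (nat \<Rightarrow> real) \<Rightarrow> real" where
  "dc_dot N a p = (\<Sum>l\<in>{1..n_dc N}. a l * p l)"

definition hybrid_grid :: "('v::finite, 'e::finite) grid \<Rightarrow> bool" where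
  "hybrid_grid N \<longleftrightarrow>
     2 \<le> CARD('v) \<and> is_tree (src N) (dst N) \<and>
     (\<forall>n. P_mat N n \<in> herm_sparse N \<and> Q_mat N n \<in> herm_sparse N) \<and>
     (\<forall>n. 0 < V_lo N n \<and> V_lo N n \<le> V_hi N n) \<and>
     (\<forall>n. gen N n \<noteq> {} \<and> compact (gen N n) \<and> convex (gen N n)) \<and>
     (\<forall>n. load N n \<noteq> {} \<and> compact (load N n) \<and> convex (load N n)) \<and>
     (\<forall>n. convex_on (gen N n) (cost N n) \<and> concave_on (load N n) (benefit N n)) \<and>
     (\<forall>k. {I_src N k, I_dst N k, M_lo N k, M_hi N k, A_mat N k, A_lo N k, A_hi N k}
            \<subseteq> herm_sparse N) \<and>
     (\<forall>k. 0 \<le> J_src N k \<and> 0 \<le> J_dst N k)"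

section \<open>The inequality constraints\<close>

text \<open>The constraints are indexed by tags instead of the numbers \<open>1, \<dots>, M\<close>. A vector in
  \<open>\<real>\<^sup>M\<close> is a function on tags of which only the values on \<open>constrs N\<close> are ever used.\<close>

datatype ('v, 'e) constr =
    V_Up 'v | V_Lo 'v
  | Cur_Src 'e | Cur_Dst 'e
  | Drop_Lo 'e | Drop_Up 'e | Ang 'e | Ang_Lo 'e | Ang_Up 'e
  | DC_Up nat | DC_Lo nat

definition constrs :: "('v::finite, 'e::finite) grid \<Rightarrow> ('v, 'e) constr set" where
  "constrs N =
     range V_Up \<union> range V_Lo \<union> range Cur_Src \<union> range Cur_Dst \<union>
     range Drop_Lo \<union> range Drop_Up \<union> range Ang \<union> range Ang_Lo \<union> range Ang_Up \<union>
     DC_Up ` {1..n_dc N} \<union> DC_Lo ` {1..n_dc N}"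

lemma finite_constrs: "finite (constrs N)"
  by (simp add: constrs_def)

lemma card_constrs:
  fixes N :: "('v::finite, 'e::finite) grid"
  shows "card (constrs N) = 2 * CARD('v) + 7 * CARD('e) + 2 * n_dc N"
proof -
  have Un: "card (A \<union> B) = a + b"
    if "card A = a" "card B = b" "finite A" "finite B" "A \<inter> B = {}"
    for A B :: "('v, 'e) constr set" and a b
    using that by (simp add: card_Un_disjoint)
  have "card (constrs N) =
      CARD('v) + CARD('v) + CARD('e) + CARD('e) + CARD('e) + CARD('e) + CARD('e) + CARD('e) + CARD('e) +
      card {1..n_dc N} + card {1..n_dc N}"
    unfolding constrs_def
    by (intro Un card_image) (simp_all add: Int_Un_distrib2 inj_on_def, blast+)
  then show ?thesis
    by simp
qed

definition unit_mat :: "'v::finite \<Rightarrow> complex^'v^'v" where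
  "unit_mat n = outer (axis n 1)"

fun C_mat :: "('v::finite, 'e::finite) grid \<Rightarrow> ('v, 'e) constr \<Rightarrow> complex^'v^'v" where
  "C_mat N (V_Up n) = unit_mat n"
| "C_mat N (V_Lo n) = - unit_mat n"
| "C_mat N (Cur_Src k) = I_src N k"
| "C_mat N (Cur_Dst k) = I_dst N k"
| "C_mat N (Drop_Lo k) = M_lo N k"
| "C_mat N (Drop_Up k) = M_hi N k"
| "C_mat N (Ang k) = A_mat N k"
| "C_mat N (Ang_Lo k) = A_lo N k"
| "C_mat N (Ang_Up k) = A_hi N k"
| "C_mat N (DC_Up l) = 0"
| "C_mat N (DC_Lo l) = 0"

fun c_vec :: "('v, 'e) constr \<Rightarrow> nat \<Rightarrow> real" where
  "c_vec (DC_Up l) = (\<lambda>j. if j = l then 1 else 0)"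
| "c_vec (DC_Lo l) = (\<lambda>j. if j = l then -1 else 0)"
| "c_vec _ = (\<lambda>j. 0)"

fun b_val :: "('v::finite, 'e::finite) grid \<Rightarrow> ('v, 'e) constr \<Rightarrow> real" where
  "b_val N (V_Up n) = (V_hi N n)\<^sup>2"
| "b_val N (V_Lo n) = - (V_lo N n)\<^sup>2"
| "b_val N (Cur_Src k) = (J_src N k)\<^sup>2"
| "b_val N (Cur_Dst k) = (J_dst N k)\<^sup>2"
| "b_val N (DC_Up l) = p_hi N l"
| "b_val N (DC_Lo l) = - p_lo N l"
| "b_val N _ = 0"

section \<open>Optimal power flow\<close>

definition power_balance ::
  "('v::finite, 'e::finite) grid \<Rightarrow> complex^'v^'v \<Rightarrow> (nat \<Rightarrow> real) \<Rightarrow>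
    ('v \<Rightarrow> real^2) \<Rightarrow> ('v \<Rightarrow> real^2) \<Rightarrow> bool" where
  "power_balance N W p g d \<longleftrightarrow>
     (\<forall>n. rtr (P_mat N n) W + dc_dot N (h_vec N n) p = (g n - d n) $ 1 \<and>
          rtr (Q_mat N n) W = (g n - d n) $ 2)"

definition constr_lhs ::
  "('v::finite, 'e::finite) grid \<Rightarrow> complex^'v^'v \<Rightarrow> (nat \<Rightarrow> real) \<Rightarrow> ('v, 'e) constr \<Rightarrow> real" where
  "constr_lhs N W p m = rtr (C_mat N m) W + dc_dot N (c_vec m) p"

definition injections ::
  "('v::finite, 'e::finite) grid \<Rightarrow> (('v \<Rightarrow> real^2) \<times> ('v \<Rightarrow> real^2)) set" where
  "injections N = {(g, d). \<forall>n. g n \<in> gen N n \<and> d n \<in> load N n}"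

definition welfare ::
  "('v::finite, 'e::finite) grid \<Rightarrow> ('v \<Rightarrow> real^2) \<Rightarrow> ('v \<Rightarrow> real^2) \<Rightarrow> real" where
  "welfare N g d = (\<Sum>n\<in>UNIV. benefit N n (d n)) - (\<Sum>n\<in>UNIV. cost N n (g n))"

definition opf_feasible ::
  "('v::finite, 'e::finite) grid \<Rightarrow> complex^'v \<Rightarrow> (nat \<Rightarrow> real) \<Rightarrow>
    ('v \<Rightarrow> real^2) \<Rightarrow> ('v \<Rightarrow> real^2) \<Rightarrow> bool" where
  "opf_feasible N v p g d \<longleftrightarrow>
     (g, d) \<in> injections N \<and> power_balance N (outer v) p g d \<and>
     (\<forall>m\<in>constrs N. constr_lhs N (outer v) p m \<le> b_val N m)"

definition strictly_feasible :: "('v::finite, 'e::finite) grid \<Rightarrow> bool" where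
  "strictly_feasible N \<longleftrightarrow>
     (\<exists>v p g d. opf_feasible N v p g d \<and>
        (\<forall>m\<in>constrs N. constr_lhs N (outer v) p m < b_val N m) \<and>
        (\<forall>n. g n - d n \<in> interior {x - y | x y. x \<in> gen N n \<and> y \<in> load N n})) \<and>
     (\<forall>n. polyhedron (gen N n) \<and> polyhedron (load N n))"

section \<open>Second-order cone relaxation\<close>

text \<open>The matrix with the two columns \<open>e\<^bsub>src k\<^esub>\<close> and \<open>e\<^bsub>dst k\<^esub>\<close>.\<close>

definition S_mat :: "('v::finite, 'e::finite) grid \<Rightarrow> 'e \<Rightarrow> complex^2^'v" where
  "S_mat N k = transpose (vector [axis (src N k) 1, axis (dst N k) 1])"

definition Xi :: "('v::finite, 'e::finite) grid \<Rightarrow> 'e \<Rightarrow> complex^'v^'v \<Rightarrow> complex^2^2" where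
  "Xi N k V = transpose (S_mat N k) ** V ** S_mat N k"

definition soc_feasible ::
  "('v::finite, 'e::finite) grid \<Rightarrow> complex^'v^'v \<Rightarrow> (nat \<Rightarrow> real) \<Rightarrow>
    ('v \<Rightarrow> real^2) \<Rightarrow> ('v \<Rightarrow> real^2) \<Rightarrow> bool" where
  "soc_feasible N V p g d \<longleftrightarrow>
     V \<in> herm_sparse N \<and> (g, d) \<in> injections N \<and> power_balance N V p g d \<and>
     (\<forall>m\<in>constrs N. constr_lhs N V p m \<le> b_val N m) \<and>
     (\<forall>k. psd (Xi N k V))"

definition soc_optimal ::
  "('v::finite, 'e::finite) grid \<Rightarrow> complex^'v^'v \<Rightarrow> (nat \<Rightarrow> real) \<Rightarrow>
    ('v \<Rightarrow> real^2) \<Rightarrow> ('v \<Rightarrow> real^2) \<Rightarrow> bool" where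
  "soc_optimal N V p g d \<longleftrightarrow>
     soc_feasible N V p g d \<and>
     (\<forall>V' p' g' d'. soc_feasible N V' p' g' d' \<longrightarrow> welfare N g' d' \<le> welfare N g d)"

definition rank1_completable :: "('v::finite, 'e::finite) grid \<Rightarrow> complex^'v^'v \<Rightarrow> bool" where
  "rank1_completable N V \<longleftrightarrow>
     (\<exists>U. psd U \<and> rank U = 1 \<and> (\<forall>(i, j)\<in>idx N. U $ i $ j = V $ i $ j))"

definition soc_exact :: "('v::finite, 'e::finite) grid \<Rightarrow> bool" where
  "soc_exact N \<longleftrightarrow> (\<exists>V p g d. soc_optimal N V p g d \<and> rank1_completable N V)"

section \<open>Dual of the second-order cone relaxation\<close>

definition Psi ::
  "('v::finite, 'e::finite) grid \<Rightarrow> ('v \<Rightarrow> real^2) \<Rightarrow> (('v, 'e) constr \<Rightarrow> real) \<Rightarrow> complex^'v^'v" where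
  "Psi N lam mu =
     (\<Sum>n\<in>UNIV. (lam n $ 1) *\<^sub>R P_mat N n + (lam n $ 2) *\<^sub>R Q_mat N n) +
     (\<Sum>m\<in>constrs N. mu m *\<^sub>R C_mat N m)"

definition psi ::
  "('v::finite, 'e::finite) grid \<Rightarrow> ('v \<Rightarrow> real^2) \<Rightarrow> (('v, 'e) constr \<Rightarrow> real) \<Rightarrow> nat \<Rightarrow> real" where
  "psi N lam mu l =
     (\<Sum>n\<in>UNIV. (lam n $ 1) * h_vec N n l) + (\<Sum>m\<in>constrs N. mu m * c_vec m l)"

text \<open>In a hybrid grid both suprema range over nonempty sets that are bounded above, because
  a concave function on a bounded convex set is bounded above.\<close>

definition sigma :: "('v::finite, 'e::finite) grid \<Rightarrow> 'v \<Rightarrow> real^2 \<Rightarrow> real" where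
  "sigma N n l = (SUP d\<in>load N n. benefit N n d - l \<bullet> d)"

definition ppi :: "('v::finite, 'e::finite) grid \<Rightarrow> 'v \<Rightarrow> real^2 \<Rightarrow> real" where
  "ppi N n l = (SUP g\<in>gen N n. l \<bullet> g - cost N n g)"

definition dual_feasible ::
  "('v::finite, 'e::finite) grid \<Rightarrow> ('v \<Rightarrow> real^2) \<Rightarrow> (('v, 'e) constr \<Rightarrow> real) \<Rightarrow>
    ('e \<Rightarrow> complex^2^2) \<Rightarrow> bool" where
  "dual_feasible N lam mu Lam \<longleftrightarrow>
     (\<forall>m\<in>constrs N. 0 \<le> mu m) \<and>
     Psi N lam mu = (\<Sum>k\<in>UNIV. S_mat N k ** Lam k ** transpose (S_mat N k)) \<and>
     (\<forall>l\<in>{1..n_dc N}. psi N lam mu l = 0) \<and>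
     (\<forall>k. psd (Lam k))"

definition dual_value ::
  "('v::finite, 'e::finite) grid \<Rightarrow> ('v \<Rightarrow> real^2) \<Rightarrow> (('v, 'e) constr \<Rightarrow> real) \<Rightarrow> real" where
  "dual_value N lam mu =
     (\<Sum>m\<in>constrs N. mu m * b_val N m) +
     (\<Sum>n\<in>UNIV. sigma N n (lam n)) + (\<Sum>n\<in>UNIV. ppi N n (lam n))"

definition dual_optimal ::
  "('v::finite, 'e::finite) grid \<Rightarrow> ('v \<Rightarrow> real^2) \<Rightarrow> (('v, 'e) constr \<Rightarrow> real) \<Rightarrow>
    ('e \<Rightarrow> complex^2^2) \<Rightarrow> bool" where
  "dual_optimal N lam mu Lam \<longleftrightarrow>
     dual_feasible N lam mu Lam \<and>
     (\<forall>lam' mu' Lam'. dual_feasible N lam' mu' Lam' \<longrightarrow> dual_value N lam mu \<le> dual_value N lam' mu')"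

definition pathological ::
  "('v::finite, 'e::finite) grid \<Rightarrow> 'e \<Rightarrow> (('v \<Rightarrow> real^2) \<times> (('v, 'e) constr \<Rightarrow> real)) set" where
  "pathological N k = {(lam, mu). Psi N lam mu $ src N k $ dst N k = 0}"

end

theory Submission
  imports Defs
begin

text \<open>Strict feasibility makes the origin an interior point of the set of constraint perturbations
  under which the SOC relaxation stays feasible, so the concave optimal value function has a
  supporting slope there. This slope is a dual solution without duality gap, hence every dual optimal
  \<open>\<Lambda>\<^sub>k\<close> satisfies \<open>tr (\<Lambda>\<^sub>k \<Xi>\<^sub>k) = 0\<close>. Distinct branches have distinct end points, so the
  off-diagonal entry of \<open>\<Lambda>\<^sub>k\<close> is an entry of \<open>\<Psi>\<close>, and it is nonzero. Then \<open>\<Lambda>\<^sub>k \<noteq> 0\<close>, and the voltage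
  bounds give \<open>\<Xi>\<^sub>k\<close> positive diagonal entries, so equality in the Cauchy-Schwarz inequality forces
  \<open>det \<Xi>\<^sub>k = 0\<close>. On a tree, such entries are the products \<open>v\<^sub>i v\<^sub>j\<^sup>*\<close> of one voltage vector \<open>v\<close>.\<close>

text \<open>What has to be earned is strong duality with an attained dual, and the strictly feasible
  point does not provide it directly: its branch blocks are outer products, on the boundary of the
  psd cone, and the power balances are equalities. The boundary is left by a shift along the
  identity. The equalities can be perturbed because the net injection at each bus may move inside
  the set of differences of generation and load. The slope found in this way is merely some dual
  solution. It serves to bound the optimal dual value by the welfare; complementary slackness for
  the given optimizer then follows from weak duality. A further obstacle is that the supremum of an
  unbounded set of reals is unspecified, so every comparison with \<open>sigma\<close> or
  \<open>ppi\<close> needs boundedness. This is obtained for the slope and then transferred to the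
  given multipliers.\<close>

section \<open>Supporting slopes\<close>

text \<open>The origin is separated from the region strictly below \<open>T\<close>. Since first
  coordinates on both sides of 0 occur, the separating line cannot be vertical, and dividing by its
  second coefficient gives the slope.\<close>

lemma supporting_slope:
  fixes T :: "(real \<times> real) set"
  assumes conv: "convex T"
    and nonpos: "\<And>t. (0, t) \<in> T \<Longrightarrow> t \<le> 0"
    and "e > 0" and inner: "\<And>w. \<bar>w\<bar> \<le> e \<Longrightarrow> \<exists>t. (w, t) \<in> T"
  shows "\<exists>y. \<forall>(u, t)\<in>T. t \<le> y * u"
proof -
  \<comment> \<open>The strict inequality keeps the origin out of \<open>H\<close> even when it lies
    in \<open>T\<close>.\<close>
  define H where "H = {(u, s). \<exists>t. (u, t) \<in> T \<and> s < t}"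
  have "convex H"
    unfolding convex_alt
  proof (intro ballI allI impI)
    fix x y \<alpha> assume "x \<in> H" "y \<in> H" and \<alpha>: "0 \<le> (\<alpha>::real) \<and> \<alpha> \<le> 1"
    then obtain u s t u' s' t' where
      *: "x = (u, s)" "(u, t) \<in> T" "s < t" "y = (u', s')" "(u', t') \<in> T" "s' < t'"
      by (auto simp: H_def)
    have "(1 - \<alpha>) *\<^sub>R (u, t) + \<alpha> *\<^sub>R (u', t') \<in> T"
      using conv * \<alpha> unfolding convex_alt by blast
    moreover have "(1 - \<alpha>) * s + \<alpha> * s' < (1 - \<alpha>) * t + \<alpha> * t'"
    proof (cases "\<alpha> = 0")
      case False
      then have "\<alpha> * s' < \<alpha> * t'" "(1 - \<alpha>) * s \<le> (1 - \<alpha>) * t"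
        using * \<alpha> by (auto intro: mult_left_mono)
      then show ?thesis by linarith
    qed (use * in simp)
    ultimately show "(1 - \<alpha>) *\<^sub>R x + \<alpha> *\<^sub>R y \<in> H"
      using * by (auto simp: H_def)
  qed
  moreover have "0 \<notin> H"
    using nonpos by (force simp: H_def zero_prod_def)
  ultimately obtain a where "a \<noteq> 0" and a: "\<forall>x\<in>H. 0 \<le> inner a x"
    using separating_hyperplane_set_0 by blast
  obtain y \<tau> where yt: "a = (y, \<tau>)" by (cases a)
  have sep: "0 \<le> y * u + \<tau> * s" if "(u, t) \<in> T" "s < t" for u s t
    using a that by (force simp: H_def yt)
  obtain t0 where t0: "(0, t0) \<in> T" using inner[of 0] \<open>e > 0\<close> by auto
  have "\<tau> \<le> 0"
  proof (rule ccontr)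
    assume "\<not> \<tau> \<le> 0"
    \<comment> \<open>The second coordinate must be negative and still below
      \<open>t0\<close>.\<close>
    moreover have "min (t0 - 1) (-1) < t0" by linarith
    note sep[OF t0 this]
    ultimately show False by (simp add: zero_le_mult_iff)
  qed
  moreover have "\<tau> \<noteq> 0"
  proof
    assume "\<tau> = 0"
    obtain t1 t2 where "(e, t1) \<in> T" "(- e, t2) \<in> T"
      using inner[of e] inner[of "- e"] \<open>e > 0\<close> by auto
    with sep[of e t1 "t1 - 1"] sep[of "- e" t2 "t2 - 1"] \<open>\<tau> = 0\<close> \<open>e > 0\<close>
    have "y = 0" by (simp add: zero_le_mult_iff mult_le_0_iff)
    with \<open>\<tau> = 0\<close> \<open>a \<noteq> 0\<close> yt show False by (simp add: zero_prod_def)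
  qed
  ultimately have "\<tau> < 0" by linarith
  \<comment> \<open>Separation covers only points strictly below \<open>T\<close>; density of the
    reals extends the bound to \<open>T\<close>.\<close>
  have "t \<le> (y / - \<tau>) * u" if "(u, t) \<in> T" for u t
  proof (rule dense_le)
    fix s assume "s < t"
    from sep[OF that this] have "- \<tau> * s \<le> y * u" by simp
    then show "s \<le> (y / - \<tau>) * u" using \<open>\<tau> < 0\<close> by (simp add: field_simps)
  qed
  then show ?thesis by blast
qed

text \<open>The multipliers are found one coordinate at a time, because the number of DC branches is
  not a type and so the perturbations do not form a Euclidean space.\<close>

lemma supporting_slopes:
  fixes T :: "(('i \<Rightarrow> real) \<times> real) set"
  assumes "finite I"
    and "\<And>u t u' t' \<alpha>. (u, t) \<in> T \<Longrightarrow> (u', t') \<in> T \<Longrightarrow> 0 \<le> \<alpha> \<Longrightarrow> \<alpha> \<le> 1 \<Longrightarrow>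
           (\<lambda>i. (1 - \<alpha>) * u i + \<alpha> * u' i, (1 - \<alpha>) * t + \<alpha> * t') \<in> T"
    and "\<And>u t. (u, t) \<in> T \<Longrightarrow> \<forall>i\<in>I. u i = 0 \<Longrightarrow> t \<le> 0"
    and "e > 0"
    and "\<And>w. \<forall>i\<in>I. \<bar>w i\<bar> \<le> e \<Longrightarrow> \<exists>u t. (u, t) \<in> T \<and> (\<forall>i\<in>I. u i = w i)"
  shows "\<exists>y. \<forall>(u, t)\<in>T. t \<le> (\<Sum>i\<in>I. y i * u i)"
  using assms
proof (induction I arbitrary: T rule: finite_induct)
  case empty
  then show ?case by auto
next
  case (insert j I)
  note conv = insert.prems(1) and nonpos = insert.prems(2) and inner = insert.prems(4)
  \<comment> \<open>The slice on which the coordinates in \<open>I\<close> vanish; its slope becomes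
    the multiplier of \<open>j\<close>.\<close>
  define R where "R = {(u j, t) |u t. (u, t) \<in> T \<and> (\<forall>i\<in>I. u i = 0)}"
  have "convex R"
    unfolding convex_alt
  proof (intro ballI allI impI)
    fix x y \<alpha> assume "x \<in> R" "y \<in> R" and \<alpha>: "0 \<le> (\<alpha>::real) \<and> \<alpha> \<le> 1"
    then obtain u t u' t' where
      *: "x = (u j, t)" "(u, t) \<in> T" "\<forall>i\<in>I. u i = 0" "y = (u' j, t')" "(u', t') \<in> T" "\<forall>i\<in>I. u' i = 0"
      by (auto simp: R_def)
    from conv[OF *(2,5)] \<alpha> have "(\<lambda>i. (1 - \<alpha>) * u i + \<alpha> * u' i, (1 - \<alpha>) * t + \<alpha> * t') \<in> T"
      by blast
    with * show "(1 - \<alpha>) *\<^sub>R x + \<alpha> *\<^sub>R y \<in> R"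
      unfolding R_def by force
  qed
  moreover have "t \<le> 0" if "(0, t) \<in> R" for t
    using that nonpos by (auto simp: R_def)
  moreover have "\<exists>t. (w, t) \<in> R" if "\<bar>w\<bar> \<le> e" for w
    using inner[of "\<lambda>i. if i = j then w else 0"] that \<open>e > 0\<close> insert.hyps(2)
    by (force simp: R_def)
  ultimately obtain yj where yj: "\<forall>(u, t)\<in>R. t \<le> yj * u"
    using supporting_slope[of R e] \<open>e > 0\<close> by blast
  \<comment> \<open>The chosen slope is subtracted while coordinate \<open>j\<close> stays free. A
    point of \<open>T'\<close> that vanishes on \<open>I\<close> comes from a point of
    \<open>R\<close>, so the bound on \<open>R\<close> is exactly the sign condition that the
    induction hypothesis asks for.\<close>
  define T' where "T' = {(u, t - yj * u j) |u t. (u, t) \<in> T}"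
  have "\<exists>y. \<forall>(u, t)\<in>T'. t \<le> (\<Sum>i\<in>I. y i * u i)"
  proof (rule insert.IH)
    fix u t u' t' and \<alpha> :: real
    assume "(u, t) \<in> T'" "(u', t') \<in> T'" and \<alpha>: "0 \<le> \<alpha>" "\<alpha> \<le> 1"
    then obtain s s' where
      *: "(u, s) \<in> T" "t = s - yj * u j" "(u', s') \<in> T" "t' = s' - yj * u' j"
      by (auto simp: T'_def)
    from conv[OF *(1,3) \<alpha>] show
      "(\<lambda>i. (1 - \<alpha>) * u i + \<alpha> * u' i, (1 - \<alpha>) * t + \<alpha> * t') \<in> T'"
      unfolding T'_def by (force simp: * algebra_simps)
  next
    fix u t assume "(u, t) \<in> T'" "\<forall>i\<in>I. u i = 0"
    then show "t \<le> 0" using yj by (fastforce simp: T'_def R_def)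
  next
    fix w :: "'i \<Rightarrow> real" assume w: "\<forall>i\<in>I. \<bar>w i\<bar> \<le> e"
    define w' where "w' = w(j := 0)"
    have "\<forall>i\<in>insert j I. \<bar>w' i\<bar> \<le> e" using w \<open>e > 0\<close> by (auto simp: w'_def)
    from inner[OF this] obtain u t where "(u, t) \<in> T" "\<forall>i\<in>insert j I. u i = w' i" by blast
    then show "\<exists>u t. (u, t) \<in> T' \<and> (\<forall>i\<in>I. u i = w i)"
      using insert.hyps(2) by (force simp: T'_def w'_def)
  qed (fact \<open>e > 0\<close>)
  then obtain y where y: "\<forall>(u, t)\<in>T'. t \<le> (\<Sum>i\<in>I. y i * u i)" by blast
  have "t \<le> (\<Sum>i\<in>insert j I. (y(j := yj)) i * u i)" if "(u, t) \<in> T" for u t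
  proof -
    have "(u, t - yj * u j) \<in> T'" using that by (auto simp: T'_def)
    with y have "t - yj * u j \<le> (\<Sum>i\<in>I. y i * u i)" by blast
    also have "\<dots> = (\<Sum>i\<in>I. (y(j := yj)) i * u i)"
      using insert.hyps(2) by (intro sum.cong) auto
    finally show ?thesis using insert.hyps by simp
  qed
  then show ?case by blast
qed

section \<open>Rank-one factorization on a tree\<close>

lemma adjacent_sym: "(u, w) \<in> adjacent s t \<longleftrightarrow> (w, u) \<in> adjacent s t"
  by (auto simp: adjacent_def insert_commute)

text \<open>One vertex is added after the other; the new vertex has a single neighbour among the old
  ones, because these are pairwise joined by simple paths and the graph has no cycle.\<close>

lemma tree_factorization:
  fixes s t :: "'e \<Rightarrow> 'v::finite" and V :: "complex^'v^'v"
  assumes "is_tree s t" and "hermitian V"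
    and diag: "\<And>n. 0 < Re (V $ n $ n)"
    and edge: "\<And>k. (cmod (V $ s k $ t k))\<^sup>2 = Re (V $ s k $ s k) * Re (V $ t k $ t k)"
  shows "\<exists>v. (\<forall>n. v $ n * cnj (v $ n) = V $ n $ n) \<and>
             (\<forall>(i, j)\<in>adjacent s t. v $ i * cnj (v $ j) = V $ i $ j)"
proof -
  let ?A = "adjacent s t"
  have herm: "V $ i $ j = cnj (V $ j $ i)" for i j
    using \<open>hermitian V\<close> unfolding hermitian_def by blast
  have real_diag: "V $ n $ n = complex_of_real (Re (V $ n $ n))" for n
    using arg_cong[OF herm[of n n], of Im] by (intro complex_eqI) auto
  have conn: "(u, w) \<in> ?A\<^sup>*" for u w
    using \<open>is_tree s t\<close> by (auto simp: is_tree_def)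
  have acyclic: "\<not> graph_cycle s t xs" for xs
    using \<open>is_tree s t\<close> by (auto simp: is_tree_def)
  have mod: "(cmod (V $ i $ j))\<^sup>2 = Re (V $ i $ i) * Re (V $ j $ j)" if ij: "(i, j) \<in> ?A" for i j
  proof -
    obtain k where "{i, j} = {s k, t k}" using ij unfolding adjacent_def by blast
    then consider "i = s k" "j = t k" | "i = t k" "j = s k"
      by (metis doubleton_eq_iff)
    then show ?thesis
    proof cases
      case 2
      then show ?thesis using edge[of k] herm[of "t k" "s k"] by simp
    qed (use edge in simp)
  qed
  define pathc where "pathc S \<longleftrightarrow> (\<forall>x\<in>S. \<forall>y\<in>S. \<exists>xs. xs \<noteq> [] \<and> distinct xs \<and> set xs \<subseteq> S \<and>
      hd xs = x \<and> last xs = y \<and> successively (\<lambda>a b. (a, b) \<in> ?A) xs)" for S :: "'v set"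
  define good where "good S \<longleftrightarrow> S \<noteq> {} \<and> pathc S \<and>
      (\<exists>v. (\<forall>n\<in>S. v $ n * cnj (v $ n) = V $ n $ n) \<and>
           (\<forall>i\<in>S. \<forall>j\<in>S. (i, j) \<in> ?A \<longrightarrow> v $ i * cnj (v $ j) = V $ i $ j))" for S :: "'v set"
  have no_loop: "(n, n) \<notin> ?A" for n
    using \<open>is_tree s t\<close> unfolding adjacent_def is_tree_def by clarsimp (metis doubleton_eq_iff)
  have base: "good {n}" for n
    unfolding good_def
  \<comment> \<open>The phase at the first vertex is arbitrary, so a real root is taken.
    \<open>good\<close> constrains the vector only on the given set, hence a constant vector
    serves.\<close>
  proof (intro conjI exI[of _ "\<chi> i. complex_of_real (sqrt (Re (V $ n $ n)))"])
    show "pathc {n}" by (auto simp: pathc_def intro!: exI[of _ "[n]"])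
    have "complex_of_real (sqrt (Re (V $ n $ n))) * complex_of_real (sqrt (Re (V $ n $ n))) = V $ n $ n"
      using diag[of n] real_diag[of n] by (metis less_eq_real_def of_real_mult real_sqrt_mult_self abs_of_pos)
    then show "\<forall>n'\<in>{n}. (\<chi> i. complex_of_real (sqrt (Re (V $ n $ n)))) $ n' *
        cnj ((\<chi> i. complex_of_real (sqrt (Re (V $ n $ n)))) $ n') = V $ n' $ n'"
      by simp
  qed (use no_loop in auto)
  have step: "good (insert w S)" if "good S" "u \<in> S" "w \<notin> S" "(u, w) \<in> ?A" for S u w
  proof -
    obtain v where v: "\<And>n. n \<in> S \<Longrightarrow> v $ n * cnj (v $ n) = V $ n $ n"
        "\<And>i j. i \<in> S \<Longrightarrow> j \<in> S \<Longrightarrow> (i, j) \<in> ?A \<Longrightarrow> v $ i * cnj (v $ j) = V $ i $ j"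
      and P: "pathc S"
      using \<open>good S\<close> by (auto simp: good_def)
    have unique: "x = u" if x: "x \<in> S" "(x, w) \<in> ?A" for x
    proof (rule ccontr)
      assume "x \<noteq> u"
      obtain xs where xs: "xs \<noteq> []" "distinct xs" "set xs \<subseteq> S" "hd xs = u" "last xs = x"
          "successively (\<lambda>a b. (a, b) \<in> ?A) xs"
        using P \<open>u \<in> S\<close> \<open>x \<in> S\<close> unfolding pathc_def by blast
      \<comment> \<open>With \<open>w\<close> added, this gives the three vertices that a cycle
        requires.\<close>
      have "2 \<le> length xs"
        using xs \<open>x \<noteq> u\<close> by (cases xs rule: remdups_adj.cases) auto
      let ?c = "xs @ [w]"
      have "successively (\<lambda>a b. (a, b) \<in> ?A) ?c"
        using xs x by (simp add: successively_append_iff)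
      moreover have "(last ?c, hd ?c) \<in> ?A"
        using xs \<open>(u, w) \<in> ?A\<close> by (simp add: adjacent_sym)
      ultimately have "(?c ! i, ?c ! (Suc i mod length ?c)) \<in> ?A" if "i < length ?c" for i
      proof (cases "Suc i < length ?c")
        case True
        then show ?thesis using \<open>successively _ ?c\<close> by (simp only: successively_conv_nth mod_less)
      next
        case False
        then have "Suc i = length ?c" using that by linarith
        then have "?c ! i = last ?c" "Suc i mod length ?c = 0"
          by (metis diff_Suc_1 last_conv_nth length_0_conv nat.distinct(1)) (simp add: \<open>Suc i = length ?c\<close>)
        moreover have "?c ! 0 = hd ?c" by (simp add: hd_conv_nth)
        ultimately show ?thesis using \<open>(last ?c, hd ?c) \<in> ?A\<close> by (simp only:)
      qed
      then have "graph_cycle s t ?c"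
        using xs \<open>w \<notin> S\<close> \<open>2 \<le> length xs\<close> unfolding graph_cycle_def by auto
      with acyclic show False by blast
    qed
    \<comment> \<open>The value at \<open>w\<close> is forced by
      \<open>v' $ u * cnj (v' $ w) = V $ u $ w\<close>. The modulus condition on the edge then makes
      its absolute square equal to the diagonal entry at \<open>w\<close>.\<close>
    define v' where "v' = (\<chi> i. if i = w then cnj (V $ u $ w / v $ u) else v $ i)"
    have v'S: "v' $ i = v $ i" if "i \<in> S" for i using that \<open>w \<notin> S\<close> by (auto simp: v'_def)
    have "v $ u \<noteq> 0" using v(1)[OF \<open>u \<in> S\<close>] diag[of u] by auto
    have uw: "v' $ u * cnj (v' $ w) = V $ u $ w"
      using \<open>v $ u \<noteq> 0\<close> \<open>u \<in> S\<close> \<open>w \<notin> S\<close> by (auto simp: v'_def)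
    have sq: "(cmod (v $ u))\<^sup>2 = Re (V $ u $ u)"
      using v(1)[OF \<open>u \<in> S\<close>] real_diag[of u] by (metis complex_norm_square of_real_eq_iff)
    have "(cmod (v' $ w))\<^sup>2 = Re (V $ w $ w)"
      using mod[OF \<open>(u, w) \<in> ?A\<close>] diag[of u] sq
      by (simp add: v'_def norm_divide power_divide)
    then have ww: "v' $ w * cnj (v' $ w) = V $ w $ w"
      by (metis complex_norm_square real_diag)
    have "good (insert w S)"
      unfolding good_def
    proof (intro conjI exI[of _ v'] ballI impI)
      show "pathc (insert w S)"
        unfolding pathc_def
      proof (intro ballI)
        fix x y assume xy: "x \<in> insert w S" "y \<in> insert w S"
        have path: "\<exists>xs. xs \<noteq> [] \<and> distinct xs \<and> set xs \<subseteq> S \<and>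
          hd xs = x \<and> last xs = y \<and> successively (\<lambda>a b. (a, b) \<in> ?A) xs" if "x \<in> S" "y \<in> S" for x y
          using P that unfolding pathc_def by blast
        show "\<exists>xs. xs \<noteq> [] \<and> distinct xs \<and> set xs \<subseteq> insert w S \<and>
          hd xs = x \<and> last xs = y \<and> successively (\<lambda>a b. (a, b) \<in> ?A) xs"
        proof (cases "x = w"; cases "y = w")
          assume "x = w" "y = w"
          then show ?thesis by (intro exI[of _ "[w]"]) auto
        next
          assume "x = w" "y \<noteq> w"
          then obtain xs where "xs \<noteq> [] \<and> distinct xs \<and> set xs \<subseteq> S \<and>
              hd xs = u \<and> last xs = y \<and> successively (\<lambda>a b. (a, b) \<in> ?A) xs"
            using path[of u y] xy \<open>u \<in> S\<close> by blast
          then show ?thesis using \<open>x = w\<close> \<open>w \<notin> S\<close> \<open>(u, w) \<in> ?A\<close>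
            by (intro exI[of _ "w # xs"]) (auto simp: successively_Cons adjacent_sym)
        next
          assume "x \<noteq> w" "y = w"
          then obtain xs where "xs \<noteq> [] \<and> distinct xs \<and> set xs \<subseteq> S \<and>
              hd xs = x \<and> last xs = u \<and> successively (\<lambda>a b. (a, b) \<in> ?A) xs"
            using path[of x u] xy \<open>u \<in> S\<close> by blast
          then show ?thesis using \<open>y = w\<close> \<open>w \<notin> S\<close> \<open>(u, w) \<in> ?A\<close>
            by (intro exI[of _ "xs @ [w]"]) (auto simp: successively_append_iff)
        next
          assume "x \<noteq> w" "y \<noteq> w"
          then show ?thesis using path[of x y] xy by blast
        qed
      qed
    next
      fix i j assume ij: "i \<in> insert w S" "j \<in> insert w S" "(i, j) \<in> ?A"
      show "v' $ i * cnj (v' $ j) = V $ i $ j"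
      proof (cases "i = w"; cases "j = w")
        assume "i = w" "j \<noteq> w"
        then have "j = u" using ij unique[of j] by (auto simp: adjacent_sym)
        then show ?thesis
          using \<open>i = w\<close> uw herm[of w u] by (metis complex_cnj_cnj complex_cnj_mult mult.commute)
      next
        assume "i \<noteq> w" "j = w"
        then have "i = u" using ij unique[of i] by auto
        then show ?thesis using \<open>j = w\<close> uw by simp
      qed (use ij no_loop v v'S in auto)
    qed (use v v'S ww in auto)
    then show ?thesis .
  qed
  have "\<exists>S. good S \<and> card S = Suc m" if "m < CARD('v)" for m
    using that
  proof (induction m)
    case 0
    then show ?case using base by (intro exI[of _ "{undefined}"]) auto
  next
    case (Suc m)
    then obtain S where S: "good S" "card S = Suc m" by auto
    obtain x where "x \<in> S" using S by (auto simp: good_def)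
    have "S \<noteq> UNIV" using S Suc.prems by auto
    then obtain z where "z \<notin> S" by auto
    \<comment> \<open>Otherwise \<open>S\<close> would contain everything reachable from
      \<open>x\<close>.\<close>
    have "\<exists>u w. u \<in> S \<and> w \<notin> S \<and> (u, w) \<in> ?A"
    proof (rule ccontr)
      assume no: "\<nexists>u w. u \<in> S \<and> w \<notin> S \<and> (u, w) \<in> ?A"
      have "(x, z) \<in> ?A\<^sup>*" by (rule conn)
      then have "z \<in> S"
        by (induction rule: rtrancl_induct) (use \<open>x \<in> S\<close> no in auto)
      with \<open>z \<notin> S\<close> show False ..
    qed
    then obtain u w where "u \<in> S" "w \<notin> S" "(u, w) \<in> ?A" by blast
    then show ?case using step[OF S(1)] S by (intro exI[of _ "insert w S"]) auto
  qed
  then obtain S where "good S" "card S = CARD('v)"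
    by (metis Suc_pred lessI zero_less_card_finite)
  then have "good UNIV" by (metis card_eq_UNIV_imp_eq_UNIV finite_class.finite_UNIV)
  then show ?thesis unfolding good_def by blast
qed

section \<open>Trace products and psd matrices\<close>

lemma rtr_eq: "rtr A W = (\<Sum>i\<in>UNIV. \<Sum>j\<in>UNIV. Re (A $ i $ j * W $ j $ i))"
  by (simp add: rtr_def trace_def matrix_matrix_mult_def)

lemma rtr_add_left: "rtr (A + B) W = rtr A W + rtr B W"
  by (simp add: rtr_eq distrib_right sum.distrib)

lemma rtr_scaleR_left: "rtr (r *\<^sub>R A) W = r * rtr A W"
  by (simp add: rtr_eq sum_distrib_left)

lemma rtr_zero_left [simp]: "rtr 0 W = 0"
  by (simp add: rtr_eq)

lemma rtr_sum_left: "rtr (sum A S) W = (\<Sum>x\<in>S. rtr (A x) W)"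
  by (induction S rule: infinite_finite_induct) (simp_all add: rtr_add_left)

lemma rtr_minus_left: "rtr (- A) W = - rtr A W"
  using rtr_scaleR_left[of "-1" A W] by simp

lemma rtr_commute: "rtr A W = rtr W A"
  unfolding rtr_def trace_mul_sym[of A W] ..

lemma rtr_add_right: "rtr A (V + W) = rtr A V + rtr A W"
  by (metis rtr_commute rtr_add_left)

lemma rtr_scaleR_right: "rtr A (r *\<^sub>R W) = r * rtr A W"
  by (metis rtr_commute rtr_scaleR_left)

lemma rtr_zero_right [simp]: "rtr A 0 = 0"
  by (simp add: rtr_eq)

lemma rtr_self:
  assumes "hermitian A"
  shows "rtr A A = (\<Sum>i\<in>UNIV. \<Sum>j\<in>UNIV. (cmod (A $ i $ j))\<^sup>2)"
  unfolding rtr_eq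
proof (intro sum.cong refl)
  fix i j
  have "A $ j $ i = cnj (A $ i $ j)" using assms unfolding hermitian_def by blast
  then have "A $ i $ j * A $ j $ i = complex_of_real ((cmod (A $ i $ j))\<^sup>2)"
    by (metis complex_norm_square)
  then show "Re (A $ i $ j * A $ j $ i) = (cmod (A $ i $ j))\<^sup>2"
    by (metis Re_complex_of_real)
qed

text \<open>The trace product of a Hermitian matrix with itself is its squared Frobenius norm. A
  single test direction therefore shows later that the residual of the dual equality
  vanishes.\<close>

lemma rtr_self_eq_0_iff:
  assumes "hermitian A"
  shows "rtr A A = 0 \<longleftrightarrow> A = 0"
proof
  assume "rtr A A = 0"
  then have "cmod (A $ i $ j) = 0" for i j
    using assms by (simp add: rtr_self sum_nonneg_eq_0_iff sum_nonneg)
  then show "A = 0" by (simp add: vec_eq_iff)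
qed simp

lemma hermitian_outer: "hermitian (outer v)"
  by (simp add: hermitian_def outer_def)

lemma rtr_outer: "rtr A (outer x) = Re (\<Sum>i\<in>UNIV. cnj (x $ i) * (A *v x) $ i)"
  by (simp add: rtr_eq outer_def matrix_vector_mult_def sum_distrib_left algebra_simps)

text \<open>As a trace product the quadratic form is linear in \<open>A\<close>. This reduces the
  cone properties of psd matrices to linearity and lets outer products act as test directions for
  the dual cone.\<close>

lemma psd_iff_outer: "psd A \<longleftrightarrow> hermitian A \<and> (\<forall>x. 0 \<le> rtr A (outer x))"
  unfolding psd_def rtr_outer ..

lemma hermitian_add: "hermitian A \<Longrightarrow> hermitian B \<Longrightarrow> hermitian (A + B)"
  unfolding hermitian_def by (metis vector_add_component complex_cnj_add)

lemma hermitian_scaleR: "hermitian A \<Longrightarrow> hermitian (r *\<^sub>R A)"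
  unfolding hermitian_def vector_scaleR_component complex_cnj_scaleR by metis

lemma psd_add: "psd A \<Longrightarrow> psd B \<Longrightarrow> psd (A + B)"
  by (simp add: psd_iff_outer hermitian_add rtr_add_left)

lemma psd_scaleR: "0 \<le> r \<Longrightarrow> psd A \<Longrightarrow> psd (r *\<^sub>R A)"
  by (simp add: psd_iff_outer hermitian_scaleR rtr_scaleR_left)

lemma rtr_outer_outer: "rtr (outer v) (outer x) = (cmod (\<Sum>i\<in>UNIV. v $ i * cnj (x $ i)))\<^sup>2"
proof -
  let ?z = "\<Sum>i\<in>UNIV. v $ i * cnj (x $ i)"
  have "rtr (outer v) (outer x) = Re (?z * cnj ?z)"
    by (simp add: rtr_eq outer_def sum_product cnj_sum algebra_simps)
  also have "\<dots> = (cmod ?z)\<^sup>2"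
    by (metis Re_complex_of_real complex_norm_square)
  finally show ?thesis .
qed

lemma psd_outer: "psd (outer v)"
  by (simp add: psd_iff_outer hermitian_outer rtr_outer_outer)

text \<open>Every row is a multiple of the conjugate of \<open>v\<close>.\<close>

lemma rank_outer:
  assumes "v \<noteq> 0"
  shows "rank (outer v) = 1"
proof -
  let ?w = "\<chi> j. cnj (v $ j)"
  obtain i where i: "v $ i \<noteq> 0" using assms by (auto simp: vec_eq_iff)
  have "?w \<noteq> 0" using i by (auto simp: vec_eq_iff)
  have row: "row j (outer v) = v $ j *s ?w" for j
    by (simp add: vec_eq_iff row_def outer_def)
  have "vec.span (rows (outer v)) = vec.span {?w}"
  proof (rule vec.span_eq[THEN iffD2], intro conjI)
    show "rows (outer v) \<subseteq> vec.span {?w}"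
      by (auto simp: rows_def row intro: vec.span_scale vec.span_base)
    have "?w = inverse (v $ i) *s row i (outer v)"
      using i by (simp add: row vector_smult_assoc)
    moreover have "row i (outer v) \<in> vec.span (rows (outer v))"
      by (intro vec.span_base) (auto simp: rows_def)
    ultimately show "{?w} \<subseteq> vec.span (rows (outer v))"
      by (metis vec.span_scale empty_subsetI insert_subset)
  qed
  then have "vec.dim (rows (outer v)) = vec.dim {?w}"
    by (metis vec.dim_span)
  also have "\<dots> = 1"
    using vec.dim_eq_card_independent[of "{?w}"] \<open>?w \<noteq> 0\<close> by simp
  finally show ?thesis by (simp add: row_rank_def_gen)
qed

section \<open>Psd matrices of order two\<close>

lemma cauchy_2:
  fixes a b x y z w :: real
  assumes "0 \<le> a" "0 \<le> b" "0 \<le> x" "0 \<le> y" "z\<^sup>2 \<le> a * b" "w\<^sup>2 \<le> x * y"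
  shows "2 * (z * w) \<le> a * x + b * y"
proof (rule power2_le_imp_le)
  have "z\<^sup>2 * w\<^sup>2 \<le> (a * b) * (x * y)" using assms by (intro mult_mono) auto
  \<comment> \<open>This is the inequality of arithmetic and geometric mean for \<open>a * x\<close>
    and \<open>b * y\<close>.\<close>
  moreover have "0 \<le> (a * x - b * y)\<^sup>2" by simp
  ultimately show "(2 * (z * w))\<^sup>2 \<le> (a * x + b * y)\<^sup>2"
    by (simp add: power2_eq_square algebra_simps)
qed (use assms in simp)

lemma rtr_2:
  fixes A B :: "complex^2^2"
  assumes "hermitian A" "hermitian B"
  shows "rtr A B = Re (A $ 1 $ 1) * Re (B $ 1 $ 1) + Re (A $ 2 $ 2) * Re (B $ 2 $ 2)
                   + 2 * Re (A $ 1 $ 2 * cnj (B $ 1 $ 2))"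
proof -
  have "A $ 2 $ 1 = cnj (A $ 1 $ 2)" "B $ 2 $ 1 = cnj (B $ 1 $ 2)"
    "A $ 1 $ 1 = cnj (A $ 1 $ 1)" "A $ 2 $ 2 = cnj (A $ 2 $ 2)"
    using assms unfolding hermitian_def by blast+
  moreover have "Im z = 0" if "z = cnj z" for z
    using arg_cong[OF that, of Im] by simp
  ultimately have "A $ 2 $ 1 = cnj (A $ 1 $ 2)" "B $ 2 $ 1 = cnj (B $ 1 $ 2)"
    "Im (A $ 1 $ 1) = 0" "Im (A $ 2 $ 2) = 0"
    by blast+
  then show ?thesis by (simp add: rtr_eq sum_2)
qed

definition psd_minors :: "complex^2^2 \<Rightarrow> bool" where
  "psd_minors A \<longleftrightarrow> 0 \<le> Re (A $ 1 $ 1) \<and> 0 \<le> Re (A $ 2 $ 2) \<and>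
     (cmod (A $ 1 $ 2))\<^sup>2 \<le> Re (A $ 1 $ 1) * Re (A $ 2 $ 2)"

text \<open>One half of the self-duality of the cone. It is phrased with minors because its instance
  with an outer product for \<open>B\<close> yields a direction of the criterion
  \<open>psd_2_iff\<close>.\<close>

lemma rtr_2_nonneg_minors:
  assumes "hermitian A" "hermitian B" "psd_minors A" "psd_minors B"
  shows "0 \<le> rtr A B"
proof -
  let ?z = "A $ 1 $ 2" and ?w = "B $ 1 $ 2"
  have "\<bar>Re (?z * cnj ?w)\<bar> \<le> cmod ?z * cmod ?w"
    using abs_Re_le_cmod[of "?z * cnj ?w"] by (simp add: norm_mult)
  moreover have "2 * (cmod ?z * cmod ?w) \<le>
      Re (A $ 1 $ 1) * Re (B $ 1 $ 1) + Re (A $ 2 $ 2) * Re (B $ 2 $ 2)"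
    using assms unfolding psd_minors_def by (intro cauchy_2) auto
  ultimately show ?thesis using assms by (simp add: rtr_2)
qed

lemma Re_mult_cnj: "Re (z * cnj z) = (cmod z)\<^sup>2"
  by (metis Re_complex_of_real complex_norm_square)

lemma psd_minors_outer: "psd_minors (outer x)"
proof -
  have "(cmod (z * cnj w))\<^sup>2 = (cmod z)\<^sup>2 * (cmod w)\<^sup>2" for z w
    by (simp add: norm_mult power_mult_distrib)
  then show ?thesis
    unfolding psd_minors_def outer_def vec_lambda_beta Re_mult_cnj by simp
qed

lemma psd_2_iff: "psd A \<longleftrightarrow> hermitian A \<and> psd_minors A" for A :: "complex^2^2"
proof
  assume "hermitian A \<and> psd_minors A"
  then show "psd A"
    by (simp add: psd_iff_outer rtr_2_nonneg_minors hermitian_outer psd_minors_outer)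
next
  assume "psd A"
  then have h: "hermitian A" and q: "\<And>x. 0 \<le> rtr A (outer x)"
    by (auto simp: psd_iff_outer)
  define a b z where "a = Re (A $ 1 $ 1)" and "b = Re (A $ 2 $ 2)" and "z = A $ 1 $ 2"
  have form: "0 \<le> a * (cmod u)\<^sup>2 + b * (cmod v)\<^sup>2 + 2 * Re (z * (cnj u * v))" for u v
    using q[of "vector [u, v]"]
    unfolding rtr_2[OF h hermitian_outer] unfolding outer_def vec_lambda_beta vector_2 Re_mult_cnj
      complex_cnj_mult complex_cnj_cnj a_def b_def z_def .
  have cross: "Re (z * (cnj (- z) * complex_of_real r)) = - (r * (cmod z)\<^sup>2)"
    "Re (z * (complex_of_real r * (- cnj z))) = - (r * (cmod z)\<^sup>2)" for r
    unfolding cmod_power2 by (simp_all add: power2_eq_square[of "Re z"] power2_eq_square[of "Im z"] algebra_simps)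
  have "0 \<le> a" "0 \<le> b" using form[of 1 0] form[of 0 1] by simp_all
  \<comment> \<open>The test vectors \<open>(- z, a)\<close> here and \<open>(b, - cnj z)\<close>
    below are the columns of the adjugate of \<open>A\<close>, so the form takes the values
    \<open>a\<close> times and \<open>b\<close> times the determinant.\<close>
  have fa: "0 \<le> a * (a * b - (cmod z)\<^sup>2)"
    using form[of "- z" "complex_of_real a"] unfolding cross norm_minus_cancel norm_of_real
    by (simp add: power2_eq_square algebra_simps)
  have fb: "0 \<le> b * (a * b - (cmod z)\<^sup>2)"
    using form[of "complex_of_real b" "- cnj z"]
    unfolding cross complex_cnj_complex_of_real norm_minus_cancel norm_of_real complex_mod_cnj
    by (simp add: power2_eq_square algebra_simps)
  \<comment> \<open>For \<open>a = b = 0\<close> the adjugate columns give no information; the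
    vector \<open>(- z, 1)\<close> then forces \<open>z = 0\<close>.\<close>
  have f1: "2 * (cmod z)\<^sup>2 \<le> a * (cmod z)\<^sup>2 + b"
    using form[of "- z" "complex_of_real 1"] unfolding cross norm_minus_cancel norm_of_real by simp
  have "(cmod z)\<^sup>2 \<le> a * b"
  proof (cases "a = 0 \<and> b = 0")
    case True
    then show ?thesis using f1 by simp
  next
    case False
    then have "0 < a \<or> 0 < b" using \<open>0 \<le> a\<close> \<open>0 \<le> b\<close> by linarith
    then have "0 \<le> a * b - (cmod z)\<^sup>2" using fa fb by (auto simp: zero_le_mult_iff)
    then show ?thesis by simp
  qed
  then show "hermitian A \<and> psd_minors A"
    using h \<open>0 \<le> a\<close> \<open>0 \<le> b\<close> by (simp add: psd_minors_def a_def b_def z_def)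
qed

lemma rtr_2_nonneg: "psd A \<Longrightarrow> psd B \<Longrightarrow> 0 \<le> rtr A B" for A B :: "complex^2^2"
  by (simp add: psd_2_iff rtr_2_nonneg_minors)

text \<open>In the notation of the proof, the vanishing trace gives
  \<open>(a * x + b * y)^2 <= 4 * |z|^2 * |w|^2 <= 4 * a * b * |w|^2\<close>, while the left side is
  at least \<open>4 * a * b * x * y\<close>. Since \<open>z\<close> is nonzero and
  \<open>|z|^2 <= a * b\<close>, the factor \<open>a * b\<close> is positive and cancels. What
  remains is the reverse of the determinant inequality for \<open>B\<close>.\<close>

lemma complementary_2:
  fixes A B :: "complex^2^2"
  assumes "psd A" "psd B" "rtr A B = 0" "A $ 1 $ 2 \<noteq> 0"
  shows "(cmod (B $ 1 $ 2))\<^sup>2 = Re (B $ 1 $ 1) * Re (B $ 2 $ 2)"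
proof -
  define a b z x y w where "a = Re (A $ 1 $ 1)" and "b = Re (A $ 2 $ 2)" and "z = A $ 1 $ 2"
    and "x = Re (B $ 1 $ 1)" and "y = Re (B $ 2 $ 2)" and "w = B $ 1 $ 2"
  note defs = a_def b_def z_def x_def y_def w_def
  have nn: "0 \<le> a" "0 \<le> b" "0 \<le> x" "0 \<le> y" "(cmod z)\<^sup>2 \<le> a * b" "(cmod w)\<^sup>2 \<le> x * y"
    using assms by (simp_all add: psd_2_iff psd_minors_def defs)
  have "a * x + b * y + 2 * Re (z * cnj w) = 0"
    using assms rtr_2[of A B] by (simp add: psd_2_iff defs)
  moreover have "\<bar>Re (z * cnj w)\<bar> \<le> cmod z * cmod w"
    using abs_Re_le_cmod[of "z * cnj w"] by (simp add: norm_mult)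
  ultimately have "a * x + b * y \<le> 2 * (cmod z * cmod w)" by linarith
  then have "(a * x + b * y)\<^sup>2 \<le> (2 * (cmod z * cmod w))\<^sup>2"
    using nn by (intro power_mono) auto
  also have "\<dots> = 4 * ((cmod z)\<^sup>2 * (cmod w)\<^sup>2)" by (simp add: power_mult_distrib)
  also have "\<dots> \<le> 4 * ((a * b) * (cmod w)\<^sup>2)"
    using nn by (intro mult_left_mono mult_right_mono) auto
  finally have "4 * ((a * x) * (b * y)) + (a * x - b * y)\<^sup>2 \<le> 4 * ((a * b) * (cmod w)\<^sup>2)"
    by (simp add: power2_eq_square algebra_simps)
  then have "4 * ((a * x) * (b * y)) \<le> 4 * ((a * b) * (cmod w)\<^sup>2)"
    using zero_le_power2[of "a * x - b * y"] by linarith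
  then have "(a * b) * (x * y) \<le> (a * b) * (cmod w)\<^sup>2" by (simp add: algebra_simps)
  moreover have "0 < (cmod z)\<^sup>2" using assms(4) by (simp add: z_def)
  then have "0 < a * b" using nn(5) by linarith
  ultimately have "x * y \<le> (cmod w)\<^sup>2" by (simp only: mult_le_cancel_left_pos)
  with nn(6) show ?thesis by (simp add: defs)
qed

text \<open>With zero determinant, \<open>B\<close> is the outer product of its first column divided
  by the root of its first diagonal entry.\<close>

lemma rank_1_2:
  fixes B :: "complex^2^2"
  assumes "hermitian B" and pos: "0 < Re (B $ 1 $ 1)"
    and det: "(cmod (B $ 1 $ 2))\<^sup>2 = Re (B $ 1 $ 1) * Re (B $ 2 $ 2)"
  shows "rank B = 1"
proof -
  define r where "r = sqrt (Re (B $ 1 $ 1))"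
  define u :: "complex^2" where "u = vector [of_real r, cnj (B $ 1 $ 2) / of_real r]"
  have "r > 0" "r * r = Re (B $ 1 $ 1)" using pos by (simp_all add: r_def)
  have B21: "B $ 2 $ 1 = cnj (B $ 1 $ 2)" and B11: "B $ 1 $ 1 = cnj (B $ 1 $ 1)"
    and B22: "B $ 2 $ 2 = cnj (B $ 2 $ 2)"
    using assms(1) unfolding hermitian_def by blast+
  have re: "z = of_real (Re z)" if "z = cnj z" for z
    using arg_cong[OF that, of Im] by (intro complex_eqI) auto
  have "cnj (B $ 1 $ 2) * B $ 1 $ 2 = of_real (r * r * Re (B $ 2 $ 2))"
    using det \<open>r * r = _\<close> by (metis complex_norm_square mult.commute)
  then have "cnj (B $ 1 $ 2) / of_real r * (B $ 1 $ 2 / of_real r) = of_real (Re (B $ 2 $ 2))"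
    using \<open>r > 0\<close> by (simp add: field_simps)
  then have "B = outer u"
    using \<open>r > 0\<close> re[OF B11] re[OF B22] B21 \<open>r * r = _\<close>
    by (simp add: vec_eq_iff forall_2 outer_def u_def del: of_real_mult flip: of_real_mult)
  moreover have "u $ 1 \<noteq> 0" using \<open>r > 0\<close> by (simp add: u_def)
  then have "u \<noteq> 0" by auto
  ultimately show ?thesis using rank_outer by blast
qed

section \<open>Branch blocks and sparse Hermitian matrices\<close>

lemma S_mat_nth: "S_mat N k $ i $ a = (if i = (if a = 1 then src N k else dst N k) then 1 else 0)"
  using exhaust_2[of a] by (auto simp: S_mat_def transpose_def axis_def)

lemma Xi_nth:
  "Xi N k V $ a $ b = V $ (if a = 1 then src N k else dst N k) $ (if b = 1 then src N k else dst N k)"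
proof -
  have pick: "(\<Sum>i\<in>UNIV. (if i = c then 1 else 0) * f i) = f c" for c :: 'a and f :: "'a \<Rightarrow> complex"
    by (simp add: mult_if_delta)
  show ?thesis
    by (simp only: Xi_def matrix_matrix_mult_def transpose_def S_mat_nth vec_lambda_beta pick
        mult.commute[of _ "if _ then 1 else 0"])
qed

text \<open>Cyclicity of the trace: the map from \<open>L\<close> to the bus matrix is the adjoint
  of \<open>Xi N k\<close>. This is the origin of the right-hand side of the dual equality.\<close>

lemma rtr_S_mat: "rtr (S_mat N k ** L ** transpose (S_mat N k)) V = rtr L (Xi N k V)"
proof -
  have "trace (S_mat N k ** L ** transpose (S_mat N k) ** V) =
        trace (S_mat N k ** (L ** transpose (S_mat N k) ** V))"
    by (simp add: matrix_mul_assoc)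
  also have "\<dots> = trace (L ** transpose (S_mat N k) ** V ** S_mat N k)"
    by (rule trace_mul_sym)
  also have "\<dots> = trace (L ** Xi N k V)"
    by (simp add: Xi_def matrix_mul_assoc)
  finally show ?thesis by (simp add: rtr_def)
qed

lemma S_mat_conj_nth:
  "(S_mat N k ** L ** transpose (S_mat N k)) $ i $ j =
     (\<Sum>a\<in>UNIV. \<Sum>b\<in>UNIV. S_mat N k $ i $ a * L $ a $ b * S_mat N k $ j $ b)"
  by (simp add: matrix_matrix_mult_def transpose_def sum_2 algebra_simps)

lemma idx_sym: "(i, j) \<in> idx N \<longleftrightarrow> (j, i) \<in> idx N"
  by (auto simp: idx_def)

lemma herm_sparse_add: "A \<in> herm_sparse N \<Longrightarrow> B \<in> herm_sparse N \<Longrightarrow> A + B \<in> herm_sparse N"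
  by (simp add: herm_sparse_def hermitian_add)

lemma herm_sparse_scaleR: "A \<in> herm_sparse N \<Longrightarrow> r *\<^sub>R A \<in> herm_sparse N"
  by (simp add: herm_sparse_def hermitian_scaleR)

lemma herm_sparse_0: "0 \<in> herm_sparse N"
  by (simp add: herm_sparse_def hermitian_def)

lemma herm_sparse_minus: "A \<in> herm_sparse N \<Longrightarrow> - A \<in> herm_sparse N"
  using herm_sparse_scaleR[of A N "-1"] by simp

lemma herm_sparse_sum: "(\<And>x. x \<in> S \<Longrightarrow> A x \<in> herm_sparse N) \<Longrightarrow> sum A S \<in> herm_sparse N"
  by (induction S rule: infinite_finite_induct) (auto simp: herm_sparse_0 herm_sparse_add)

text \<open>A connected graph with at least two vertices has no isolated vertex. Hence diagonal
  matrices, among them \<open>unit_mat n\<close> and the identity, respect the sparsity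
  pattern.\<close>

lemma idx_refl:
  fixes N :: "('v::finite, 'e::finite) grid"
  assumes "hybrid_grid N"
  shows "(n, n) \<in> idx N"
proof -
  have "2 \<le> CARD('v)" and conn: "\<And>u w. (u, w) \<in> (adjacent (src N) (dst N))\<^sup>*"
    using assms by (auto simp: hybrid_grid_def is_tree_def)
  have "UNIV \<noteq> {n}" using \<open>2 \<le> CARD('v)\<close> by (metis card_1_singleton_iff One_nat_def Suc_1 not_less_eq_eq order_refl)
  then obtain m where "n \<noteq> m" by (metis UNIV_eq_I singleton_iff)
  with conn[of n m] obtain w where "(n, w) \<in> adjacent (src N) (dst N)"
    by (meson converse_rtranclE)
  then show ?thesis
    unfolding adjacent_def idx_def by blast
qed

lemma unit_mat_nth: "unit_mat n $ i $ j = (if i = n \<and> j = n then 1 else 0)"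
  by (simp add: unit_mat_def outer_def axis_def)

lemma C_mat_herm_sparse:
  assumes "hybrid_grid N"
  shows "C_mat N m \<in> herm_sparse N"
proof -
  have "unit_mat n \<in> herm_sparse N" for n
    using idx_refl[OF assms, of n] by (auto simp: herm_sparse_def unit_mat_nth hermitian_def)
  then show ?thesis
    using assms by (cases m) (auto simp: hybrid_grid_def herm_sparse_minus herm_sparse_0)
qed

lemma Psi_herm_sparse:
  assumes "hybrid_grid N"
  shows "Psi N lam mu \<in> herm_sparse N"
  unfolding Psi_def
  using assms C_mat_herm_sparse[OF assms]
  by (intro herm_sparse_add herm_sparse_sum herm_sparse_scaleR) (auto simp: hybrid_grid_def)

lemma S_mat_conj_herm_sparse:
  assumes "hermitian L"
  shows "S_mat N k ** L ** transpose (S_mat N k) \<in> herm_sparse N"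
proof -
  have L: "cnj (L $ a $ b) = L $ b $ a" for a b
    using assms unfolding hermitian_def by (metis complex_cnj_cnj)
  have S: "cnj (S_mat N k $ i $ a) = S_mat N k $ i $ a" for i a
    by (simp add: S_mat_nth)
  show ?thesis
    unfolding herm_sparse_def mem_Collect_eq hermitian_def
  proof (intro conjI allI impI)
    fix i j
    show "(S_mat N k ** L ** transpose (S_mat N k)) $ i $ j
      = cnj ((S_mat N k ** L ** transpose (S_mat N k)) $ j $ i)"
      unfolding S_mat_conj_nth cnj_sum complex_cnj_mult L S
      by (subst sum.swap) (simp add: mult_ac)
    assume "(i, j) \<notin> idx N"
    then have "S_mat N k $ i $ a = 0 \<or> S_mat N k $ j $ b = 0" for a b
      unfolding idx_def S_mat_nth by auto
    then show "(S_mat N k ** L ** transpose (S_mat N k)) $ i $ j = 0"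
      unfolding S_mat_conj_nth by (intro sum.neutral ballI) (metis mult_eq_0_iff)
  qed
qed

lemma hermitian_Xi: "hermitian V \<Longrightarrow> hermitian (Xi N k V)"
  unfolding hermitian_def Xi_nth by blast

lemma Xi_add: "Xi N k (V + W) = Xi N k V + Xi N k W"
  by (simp add: vec_eq_iff Xi_nth)

lemma Xi_scaleR: "Xi N k (r *\<^sub>R V) = r *\<^sub>R Xi N k V"
  by (simp add: vec_eq_iff Xi_nth)

lemma Xi_0 [simp]: "Xi N k 0 = 0"
  by (simp add: vec_eq_iff Xi_nth)

text \<open>The Lagrangian regrouped by primal variables. It is used twice: to read the dual
  constraints off the slope, and for weak duality at the given optimizer.\<close>

lemma lagrangian_eq:
  "(\<Sum>n\<in>UNIV. lam n $ 1 * (rtr (P_mat N n) W + dc_dot N (h_vec N n) p) + lam n $ 2 * rtr (Q_mat N n) W)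
     + (\<Sum>m\<in>constrs N. mu m * constr_lhs N W p m)
   = rtr (Psi N lam mu) W + dc_dot N (psi N lam mu) p"
proof -
  have "dc_dot N (psi N lam mu) p =
      (\<Sum>n\<in>UNIV. lam n $ 1 * dc_dot N (h_vec N n) p) + (\<Sum>m\<in>constrs N. mu m * dc_dot N (c_vec m) p)"
    unfolding dc_dot_def psi_def distrib_right sum.distrib sum_distrib_left sum_distrib_right
    by (subst (1 2) sum.swap) (simp add: mult.assoc)
  then show ?thesis
    by (simp add: Psi_def constr_lhs_def rtr_add_left rtr_sum_left rtr_scaleR_left
        distrib_left sum.distrib)
qed

text \<open>The components are chosen independently, so a joint bound passes to the sum of the
  separate suprema. Freezing all components but one shows that each supremum is over a bounded
  set.\<close>

lemma sum_SUP_le: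
  fixes F :: "'n::finite \<Rightarrow> 'b \<Rightarrow> real"
  assumes ne: "\<And>n. A n \<noteq> {}"
    and le: "\<And>x. (\<And>n. x n \<in> A n) \<Longrightarrow> (\<Sum>n\<in>UNIV. F n (x n)) \<le> c"
  shows "bdd_above (F n ` A n)" and "(\<Sum>n\<in>UNIV. SUP a\<in>A n. F n a) \<le> c"
proof -
  obtain x0 where x0: "\<And>n. x0 n \<in> A n" by (rule that[of "\<lambda>n. SOME a. a \<in> A n"]) (simp add: some_in_eq ne)
  show bdd: "bdd_above (F n ` A n)" for n
  proof (rule bdd_aboveI2)
    fix a assume "a \<in> A n"
    then have "(\<Sum>m\<in>UNIV. F m ((x0(n := a)) m)) \<le> c" using x0 by (intro le) auto
    moreover have "(\<Sum>m\<in>UNIV. F m ((x0(n := a)) m)) = F n a + (\<Sum>m\<in>UNIV - {n}. F m (x0 m))"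
      by (simp add: sum.remove[of UNIV n])
    ultimately show "F n a \<le> c - (\<Sum>m\<in>UNIV - {n}. F m (x0 m))" by linarith
  qed
  show "(\<Sum>n\<in>UNIV. SUP a\<in>A n. F n a) \<le> c"
  proof (rule field_le_epsilon)
    fix e :: real assume "e > 0"
    \<comment> \<open>The suprema need not be attained, so each component receives an equal share of
      the error.\<close>
    define r where "r = e / real CARD('n)"
    have "r > 0" using \<open>e > 0\<close> by (simp add: r_def)
    have "\<exists>a\<in>A n. (SUP a\<in>A n. F n a) - r < F n a" for n
      using less_cSUP_iff[OF ne bdd, of "(SUP a\<in>A n. F n a) - r" n] \<open>r > 0\<close> by simp
    then obtain x where x: "\<And>n. x n \<in> A n" "\<And>n. (SUP a\<in>A n. F n a) - r < F n (x n)"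
      by metis
    have "(\<Sum>n\<in>UNIV. (SUP a\<in>A n. F n a) - r) \<le> (\<Sum>n\<in>UNIV. F n (x n))"
      using x(2) by (intro sum_mono) (simp add: less_imp_le)
    also have "\<dots> \<le> c" using x(1) by (rule le)
    finally show "(\<Sum>n\<in>UNIV. SUP a\<in>A n. F n a) \<le> c + e"
      by (simp add: sum_subtractf r_def)
  qed
qed

section \<open>Strong duality\<close>

text \<open>One real coordinate per scalar constraint. A Hermitian branch block contributes four:
  two real diagonal entries and the two parts of the complex off-diagonal entry.\<close>

datatype ('v, 'e) coord =
    Active 'v | Reactive 'v | Ineq "('v, 'e) constr"
  | Diag1 'e | Diag2 'e | OffRe 'e | OffIm 'e

definition coords :: "('v::finite, 'e::finite) grid \<Rightarrow> ('v, 'e) coord set" where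
  "coords N = range Active \<union> range Reactive \<union> Ineq ` constrs N \<union>
     range Diag1 \<union> range Diag2 \<union> range OffRe \<union> range OffIm"

definition block :: "(('v, 'e) coord \<Rightarrow> real) \<Rightarrow> 'e \<Rightarrow> complex^2^2" where
  "block u k = vector [vector [of_real (u (Diag1 k)), Complex (u (OffRe k)) (u (OffIm k))],
                       vector [Complex (u (OffRe k)) (- u (OffIm k)), of_real (u (Diag2 k))]]"

lemma hermitian_block: "hermitian (block u k)"
  by (simp add: hermitian_def forall_2 block_def complex_eq_iff)

lemma block_combine:
  "block (\<lambda>i. a * u i + b * u' i) k = a *\<^sub>R block u k + b *\<^sub>R block u' k"
  by (simp add: vec_eq_iff forall_2 block_def complex_eq_iff)

lemma block_0: "u (Diag1 k) = 0 \<Longrightarrow> u (Diag2 k) = 0 \<Longrightarrow> u (OffRe k) = 0 \<Longrightarrow> u (OffIm k) = 0 \<Longrightarrow> block u k = 0"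
  by (simp add: vec_eq_iff forall_2 block_def complex_eq_iff)

lemma block_eqI:
  assumes "hermitian Y" "u (Diag1 k) = Re (Y $ 1 $ 1)" "u (Diag2 k) = Re (Y $ 2 $ 2)"
    "u (OffRe k) = Re (Y $ 1 $ 2)" "u (OffIm k) = Im (Y $ 1 $ 2)"
  shows "block u k = Y"
proof -
  have "Y $ 2 $ 1 = cnj (Y $ 1 $ 2)" and d: "Y $ a $ a = cnj (Y $ a $ a)" for a
    using assms(1) unfolding hermitian_def by blast+
  moreover have "Im (Y $ a $ a) = 0" for a
    using arg_cong[OF d[of a], of Im] by simp
  ultimately show ?thesis
    using assms(2-) by (simp add: vec_eq_iff forall_2 block_def complex_eq_iff)
qed

text \<open>Half of the off-diagonal multipliers, because the trace product counts them twice.\<close>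

definition multiplier_block :: "(('v, 'e) coord \<Rightarrow> real) \<Rightarrow> 'e \<Rightarrow> complex^2^2" where
  "multiplier_block y k = block (\<lambda>i. case i of OffRe _ \<Rightarrow> y i / 2 | OffIm _ \<Rightarrow> y i / 2 | _ \<Rightarrow> y i) k"

lemma rtr_multiplier_block:
  "rtr (multiplier_block y k) (block u k) =
     y (Diag1 k) * u (Diag1 k) + y (Diag2 k) * u (Diag2 k) + y (OffRe k) * u (OffRe k) + y (OffIm k) * u (OffIm k)"
  unfolding multiplier_block_def rtr_2[OF hermitian_block hermitian_block]
  by (simp add: block_def algebra_simps)

lemma finite_coords: "finite (coords N)"
  by (simp add: coords_def finite_constrs)

lemma sum_coords:
  fixes N :: "('v::finite, 'e::finite) grid" and f :: "('v, 'e) coord \<Rightarrow> real"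
  shows "(\<Sum>i\<in>coords N. f i) =
    (\<Sum>n\<in>UNIV. f (Active n) + f (Reactive n)) + (\<Sum>m\<in>constrs N. f (Ineq m)) +
    (\<Sum>k\<in>UNIV. f (Diag1 k) + f (Diag2 k) + f (OffRe k) + f (OffIm k))"
proof -
  have im: "sum f (c ` A) = (\<Sum>x\<in>A. f (c x))" if "inj c" for c :: "'x \<Rightarrow> _" and A
    using that by (simp add: sum.reindex inj_on_subset[OF that] o_def)
  have un: "sum f (A \<union> B) = a + b"
    if "sum f A = a" "sum f B = b" "finite A" "finite B" "A \<inter> B = {}" for A B a b
    using that by (simp add: sum.union_disjoint)
  have "(\<Sum>i\<in>coords N. f i) =
    sum f (range Active) + sum f (range Reactive) + sum f (Ineq ` constrs N) +
     sum f (range Diag1) + sum f (range Diag2) + sum f (range OffRe) + sum f (range OffIm)"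
    unfolding coords_def by (intro un refl) (auto simp: finite_constrs)
  then show ?thesis
    by (simp add: im inj_def sum.distrib)
qed

text \<open>The coordinates \<open>u\<close> are perturbations of the constraints of the SOC relaxation and \<open>t\<close> is a
  lower bound for the welfare gained relative to \<open>c\<close>.\<close>

definition perturbed ::
  "('v::finite, 'e::finite) grid \<Rightarrow> real \<Rightarrow> ((('v, 'e) coord \<Rightarrow> real) \<times> real) set" where
  "perturbed N c = {(u, t). \<exists>V p g d. V \<in> herm_sparse N \<and> (g, d) \<in> injections N \<and>
     (\<forall>n. u (Active n) = rtr (P_mat N n) V + dc_dot N (h_vec N n) p - (g n - d n) $ 1 \<and>
          u (Reactive n) = rtr (Q_mat N n) V - (g n - d n) $ 2) \<and>
     (\<forall>m\<in>constrs N. constr_lhs N V p m - b_val N m \<le> u (Ineq m)) \<and>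
     (\<forall>k. psd (Xi N k V + block u k)) \<and>
     t \<le> welfare N g d - c}"

lemma perturbedI:
  assumes "V \<in> herm_sparse N" "(g, d) \<in> injections N"
    "\<And>n. u (Active n) = rtr (P_mat N n) V + dc_dot N (h_vec N n) p - (g n - d n) $ 1"
    "\<And>n. u (Reactive n) = rtr (Q_mat N n) V - (g n - d n) $ 2"
    "\<And>m. m \<in> constrs N \<Longrightarrow> constr_lhs N V p m - b_val N m \<le> u (Ineq m)"
    "\<And>k. psd (Xi N k V + block u k)" "t \<le> welfare N g d - c"
  shows "(u, t) \<in> perturbed N c"
  using assms unfolding perturbed_def by blast

lemma perturbedE:
  assumes "(u, t) \<in> perturbed N c"
  obtains V p g d where "V \<in> herm_sparse N" "(g, d) \<in> injections N"
    "\<And>n. u (Active n) = rtr (P_mat N n) V + dc_dot N (h_vec N n) p - (g n - d n) $ 1"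
    "\<And>n. u (Reactive n) = rtr (Q_mat N n) V - (g n - d n) $ 2"
    "\<And>m. m \<in> constrs N \<Longrightarrow> constr_lhs N V p m - b_val N m \<le> u (Ineq m)"
    "\<And>k. psd (Xi N k V + block u k)" "t \<le> welfare N g d - c"
  using assms unfolding perturbed_def by blast

lemma dc_dot_combine: "dc_dot N a (\<lambda>l. r * p l + s * q l) = r * dc_dot N a p + s * dc_dot N a q"
  by (simp add: dc_dot_def distrib_left sum.distrib sum_distrib_left mult.left_commute)

lemma constr_lhs_combine:
  "constr_lhs N (r *\<^sub>R V + s *\<^sub>R W) (\<lambda>l. r * p l + s * q l) m =
     r * constr_lhs N V p m + s * constr_lhs N W q m"
  by (simp add: constr_lhs_def dc_dot_combine rtr_add_right rtr_scaleR_right algebra_simps)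

lemma welfare_concave:
  assumes "hybrid_grid N" "(g, d) \<in> injections N" "(g', d') \<in> injections N" "0 \<le> \<alpha>" "\<alpha> \<le> 1"
  shows "(\<lambda>n. (1 - \<alpha>) *\<^sub>R g n + \<alpha> *\<^sub>R g' n, \<lambda>n. (1 - \<alpha>) *\<^sub>R d n + \<alpha> *\<^sub>R d' n) \<in> injections N" (is ?A)
    and "(1 - \<alpha>) * welfare N g d + \<alpha> * welfare N g' d'
       \<le> welfare N (\<lambda>n. (1 - \<alpha>) *\<^sub>R g n + \<alpha> *\<^sub>R g' n) (\<lambda>n. (1 - \<alpha>) *\<^sub>R d n + \<alpha> *\<^sub>R d' n)" (is ?B)
proof -
  have cvx: "convex (gen N n)" "convex (load N n)"
    "convex_on (gen N n) (cost N n)" "concave_on (load N n) (benefit N n)" for n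
    using assms(1) by (auto simp: hybrid_grid_def)
  have inj: "g n \<in> gen N n" "g' n \<in> gen N n" "d n \<in> load N n" "d' n \<in> load N n" for n
    using assms by (auto simp: injections_def)
  show ?A
    using cvx(1,2) inj assms(4,5) unfolding injections_def convex_alt by blast
  have "(\<Sum>n\<in>UNIV. (1 - \<alpha>) * benefit N n (d n) + \<alpha> * benefit N n (d' n))
      \<le> (\<Sum>n\<in>UNIV. benefit N n ((1 - \<alpha>) *\<^sub>R d n + \<alpha> *\<^sub>R d' n))"
    using assms(4,5) by (intro sum_mono concave_onD[OF cvx(4)] inj)
  moreover have "(\<Sum>n\<in>UNIV. cost N n ((1 - \<alpha>) *\<^sub>R g n + \<alpha> *\<^sub>R g' n))
      \<le> (\<Sum>n\<in>UNIV. (1 - \<alpha>) * cost N n (g n) + \<alpha> * cost N n (g' n))"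
    using assms(4,5) by (intro sum_mono convex_onD[OF cvx(3)] inj)
  ultimately show ?B
    by (simp add: welfare_def sum.distrib sum_distrib_left[symmetric] right_diff_distrib)
qed

text \<open>All constraints are jointly affine or convex in point and perturbation, and
  \<open>t\<close> only bounds a concave welfare from below, so the combination of the witnesses is
  a witness.\<close>

lemma perturbed_convex:
  assumes N: "hybrid_grid N" and "(u, t) \<in> perturbed N c" "(u', t') \<in> perturbed N c"
    and \<alpha>: "0 \<le> \<alpha>" "\<alpha> \<le> 1"
  shows "(\<lambda>i. (1 - \<alpha>) * u i + \<alpha> * u' i, (1 - \<alpha>) * t + \<alpha> * t') \<in> perturbed N c"
proof -
  from assms(2) obtain V p g d where 1: "V \<in> herm_sparse N" "(g, d) \<in> injections N"
    "\<And>n. u (Active n) = rtr (P_mat N n) V + dc_dot N (h_vec N n) p - (g n - d n) $ 1"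
    "\<And>n. u (Reactive n) = rtr (Q_mat N n) V - (g n - d n) $ 2"
    "\<And>m. m \<in> constrs N \<Longrightarrow> constr_lhs N V p m - b_val N m \<le> u (Ineq m)"
    "\<And>k. psd (Xi N k V + block u k)" "t \<le> welfare N g d - c"
    by (rule perturbedE) (rule that)
  from assms(3) obtain V' p' g' d' where 2: "V' \<in> herm_sparse N" "(g', d') \<in> injections N"
    "\<And>n. u' (Active n) = rtr (P_mat N n) V' + dc_dot N (h_vec N n) p' - (g' n - d' n) $ 1"
    "\<And>n. u' (Reactive n) = rtr (Q_mat N n) V' - (g' n - d' n) $ 2"
    "\<And>m. m \<in> constrs N \<Longrightarrow> constr_lhs N V' p' m - b_val N m \<le> u' (Ineq m)"
    "\<And>k. psd (Xi N k V' + block u' k)" "t' \<le> welfare N g' d' - c"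
    by (rule perturbedE) (rule that)
  show ?thesis
  proof (rule perturbedI[where V = "(1 - \<alpha>) *\<^sub>R V + \<alpha> *\<^sub>R V'" and p = "\<lambda>l. (1 - \<alpha>) * p l + \<alpha> * p' l"])
    show "(\<lambda>n. (1 - \<alpha>) *\<^sub>R g n + \<alpha> *\<^sub>R g' n, \<lambda>n. (1 - \<alpha>) *\<^sub>R d n + \<alpha> *\<^sub>R d' n) \<in> injections N"
      by (rule welfare_concave(1)[OF N 1(2) 2(2) \<alpha>])
    have "(1 - \<alpha>) * t + \<alpha> * t' \<le> (1 - \<alpha>) * (welfare N g d - c) + \<alpha> * (welfare N g' d' - c)"
      using 1(7) 2(7) \<alpha> by (intro add_mono mult_left_mono) auto
    also have "\<dots> = (1 - \<alpha>) * welfare N g d + \<alpha> * welfare N g' d' - c"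
      by (simp add: algebra_simps)
    finally show "(1 - \<alpha>) * t + \<alpha> * t' \<le>
        welfare N (\<lambda>n. (1 - \<alpha>) *\<^sub>R g n + \<alpha> *\<^sub>R g' n) (\<lambda>n. (1 - \<alpha>) *\<^sub>R d n + \<alpha> *\<^sub>R d' n) - c"
      using welfare_concave(2)[OF N 1(2) 2(2) \<alpha>] by linarith
  next
    fix m assume m: "m \<in> constrs N"
    have "(1 - \<alpha>) * (constr_lhs N V p m - b_val N m) + \<alpha> * (constr_lhs N V' p' m - b_val N m)
       \<le> (1 - \<alpha>) * u (Ineq m) + \<alpha> * u' (Ineq m)"
      using 1(5)[OF m] 2(5)[OF m] \<alpha> by (intro add_mono mult_left_mono) auto
    then show "constr_lhs N ((1 - \<alpha>) *\<^sub>R V + \<alpha> *\<^sub>R V') (\<lambda>l. (1 - \<alpha>) * p l + \<alpha> * p' l) m - b_val N m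
       \<le> (1 - \<alpha>) * u (Ineq m) + \<alpha> * u' (Ineq m)"
      unfolding constr_lhs_combine by (simp add: algebra_simps)
  next
    fix k
    have "psd ((1 - \<alpha>) *\<^sub>R (Xi N k V + block u k) + \<alpha> *\<^sub>R (Xi N k V' + block u' k))"
      by (rule psd_add; rule psd_scaleR) (use \<alpha> 1(6) 2(6) in auto)
    then show "psd (Xi N k ((1 - \<alpha>) *\<^sub>R V + \<alpha> *\<^sub>R V') + block (\<lambda>i. (1 - \<alpha>) * u i + \<alpha> * u' i) k)"
      unfolding block_combine Xi_add Xi_scaleR scaleR_add_right by (simp only: ac_simps)
  qed (simp_all add: 1 2 herm_sparse_add herm_sparse_scaleR rtr_add_right rtr_scaleR_right
      dc_dot_combine, simp_all add: algebra_simps)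
qed

lemma perturbed_nonpos:
  assumes opt: "\<And>V p g d. soc_feasible N V p g d \<Longrightarrow> welfare N g d \<le> c"
    and "(u, t) \<in> perturbed N c" and u: "\<forall>i\<in>coords N. u i = 0"
  shows "t \<le> 0"
proof -
  from assms(2) obtain V p g d where *: "V \<in> herm_sparse N" "(g, d) \<in> injections N"
    "\<And>n. u (Active n) = rtr (P_mat N n) V + dc_dot N (h_vec N n) p - (g n - d n) $ 1"
    "\<And>n. u (Reactive n) = rtr (Q_mat N n) V - (g n - d n) $ 2"
    "\<And>m. m \<in> constrs N \<Longrightarrow> constr_lhs N V p m - b_val N m \<le> u (Ineq m)"
    "\<And>k. psd (Xi N k V + block u k)" "t \<le> welfare N g d - c"
    by (rule perturbedE) (rule that)
  have 0: "u (Active n) = 0" "u (Reactive n) = 0" "u (Diag1 k) = 0" "u (Diag2 k) = 0"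
    "u (OffRe k) = 0" "u (OffIm k) = 0" for n k
    using u by (simp_all add: coords_def)
  have 1: "u (Ineq m) = 0" if "m \<in> constrs N" for m
    using u that by (simp add: coords_def)
  have "power_balance N V p g d"
    unfolding power_balance_def using *(3,4) 0(1,2) by (metis eq_iff_diff_eq_0)
  moreover have "constr_lhs N V p m \<le> b_val N m" if "m \<in> constrs N" for m
    using *(5)[OF that] 1[OF that] by simp
  moreover have "psd (Xi N k V)" for k
    using *(6)[of k] block_0[of u k] 0 by simp
  ultimately have "soc_feasible N V p g d"
    using *(1,2) by (simp add: soc_feasible_def)
  from opt[OF this] *(7) show ?thesis by linarith
qed

text \<open>Adding a small multiple of the identity to the sparse part of \<open>v v\<^sup>H\<close> makes all blocks
  positive definite, while the strict inequalities and the interior condition absorb the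
  change.\<close>

lemma perturbed_interior:
  fixes N :: "('v::finite, 'e::finite) grid"
  assumes N: "hybrid_grid N" and "strictly_feasible N"
  shows "\<exists>e>0. \<forall>w. (\<forall>i\<in>coords N. \<bar>w i\<bar> \<le> e) \<longrightarrow> (\<exists>u t. (u, t) \<in> perturbed N c \<and> (\<forall>i\<in>coords N. u i = w i))"
proof -
  obtain v p g d where opf: "opf_feasible N v p g d"
    and strict: "\<And>m. m \<in> constrs N \<Longrightarrow> constr_lhs N (outer v) p m < b_val N m"
    and int: "\<And>n. g n - d n \<in> interior {x - y | x y. x \<in> gen N n \<and> y \<in> load N n}"
    using assms(2) unfolding strictly_feasible_def by blast
  define X where "X n = {x - y | x y. x \<in> gen N n \<and> y \<in> load N n}" for n
  have "\<exists>r>0. ball (g n - d n) r \<subseteq> X n" for n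
    using int[of n] by (simp add: mem_interior X_def)
  then obtain \<rho> where \<rho>: "\<And>n. \<rho> n > 0" "\<And>n. ball (g n - d n) (\<rho> n) \<subseteq> X n"
    by metis
  let ?one = "mat 1 :: complex^'v^'v"
  define gap where "gap m = b_val N m - constr_lhs N (outer v) p m" for m
  define R where "R = insert 1 (range \<rho> \<union> gap ` constrs N)"
  define r where "r = Min R"
  have "finite R" "R \<noteq> {}" by (simp_all add: R_def finite_constrs)
  moreover have "\<forall>x\<in>R. 0 < x" using strict \<rho>(1) by (auto simp: R_def gap_def)
  ultimately have "r > 0" by (simp add: r_def)
  have r: "r \<le> \<rho> n" "m \<in> constrs N \<Longrightarrow> r \<le> gap m" for n m
    unfolding r_def by (rule Min_le[OF \<open>finite R\<close>]; simp add: R_def)+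
  \<comment> \<open>\<open>K\<close> dominates the effect of the identity on every balance and
    inequality; the summand 1 ensures \<open>\<delta> \<le> \<delta> * K\<close>.\<close>
  define K where "K = 1 + (\<Sum>n\<in>UNIV. \<bar>rtr (P_mat N n) ?one\<bar> + \<bar>rtr (Q_mat N n) ?one\<bar>)
                       + (\<Sum>m\<in>constrs N. \<bar>rtr (C_mat N m) ?one\<bar>)"
  have "1 \<le> K" by (simp add: K_def sum_nonneg)
  have KP: "\<bar>rtr (P_mat N n) ?one\<bar> + \<bar>rtr (Q_mat N n) ?one\<bar> \<le> K" for n
  proof -
    have "\<bar>rtr (P_mat N n) ?one\<bar> + \<bar>rtr (Q_mat N n) ?one\<bar>
       \<le> (\<Sum>n\<in>UNIV. \<bar>rtr (P_mat N n) ?one\<bar> + \<bar>rtr (Q_mat N n) ?one\<bar>)"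
      by (rule member_le_sum) auto
    moreover have "0 \<le> (\<Sum>m\<in>constrs N. \<bar>rtr (C_mat N m) ?one\<bar>)" by (simp add: sum_nonneg)
    ultimately show ?thesis unfolding K_def by linarith
  qed
  have KC: "\<bar>rtr (C_mat N m) ?one\<bar> \<le> K" if "m \<in> constrs N" for m
  proof -
    have "\<bar>rtr (C_mat N m) ?one\<bar> \<le> (\<Sum>m\<in>constrs N. \<bar>rtr (C_mat N m) ?one\<bar>)"
      by (rule member_le_sum) (use that finite_constrs in auto)
    moreover have "0 \<le> (\<Sum>n\<in>UNIV. \<bar>rtr (P_mat N n) ?one\<bar> + \<bar>rtr (Q_mat N n) ?one\<bar>)"
      by (simp add: sum_nonneg)
    ultimately show ?thesis unfolding K_def by linarith
  qed
  \<comment> \<open>The shift costs at most \<open>\<delta> * K = r / 4\<close> and the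
    perturbations at most \<open>2 * e \<le> r / 8\<close>. As \<open>\<delta> = 4 * e\<close>, the
    shift plus a block perturbation has diagonal entries at least \<open>3 * e\<close>, enough
    against an off-diagonal modulus of at most \<open>sqrt 2 * e\<close>.\<close>
  define \<delta> where "\<delta> = r / (4 * K)"
  define e where "e = \<delta> / 4"
  have "\<delta> > 0" "e > 0" using \<open>r > 0\<close> \<open>1 \<le> K\<close> by (simp_all add: \<delta>_def e_def)
  have "\<delta> * K = r / 4" using \<open>1 \<le> K\<close> by (simp add: \<delta>_def)
  moreover have "\<delta> * 1 \<le> \<delta> * K" using \<open>1 \<le> K\<close> \<open>\<delta> > 0\<close> by (intro mult_left_mono) auto
  ultimately have small: "\<delta> * K + 2 * e < r" using \<open>r > 0\<close> by (simp add: e_def)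
  \<comment> \<open>Discarding the entries outside \<open>idx N\<close> changes no trace product
    with a sparse matrix and keeps every branch block an outer product.\<close>
  define W where "W = (\<chi> i j. if (i, j) \<in> idx N then outer v $ i $ j else 0)"
  define V where "V = W + \<delta> *\<^sub>R ?one"
  have W: "W \<in> herm_sparse N"
    using idx_sym[of _ _ N] unfolding herm_sparse_def hermitian_def by (auto simp: W_def outer_def)
  have one: "?one \<in> herm_sparse N"
    using idx_refl[OF N] by (auto simp: herm_sparse_def hermitian_def mat_def)
  have V: "V \<in> herm_sparse N"
    unfolding V_def by (intro herm_sparse_add herm_sparse_scaleR W one)
  have rtrW: "rtr A W = rtr A (outer v)" if "A \<in> herm_sparse N" for A
    unfolding rtr_eq
  proof (intro sum.cong refl)
    fix i j
    show "Re (A $ i $ j * W $ j $ i) = Re (A $ i $ j * outer v $ j $ i)"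
      using that idx_sym[of i j N] unfolding W_def herm_sparse_def by auto
  qed
  have rtrV: "rtr A V = rtr A (outer v) + \<delta> * rtr A ?one" if "A \<in> herm_sparse N" for A
    by (simp add: V_def rtr_add_right rtr_scaleR_right rtrW that)
  have PQ: "P_mat N n \<in> herm_sparse N" "Q_mat N n \<in> herm_sparse N" for n
    using N by (auto simp: hybrid_grid_def)
  have XiW: "psd (Xi N k W)" for k
  proof -
    have "Xi N k W = outer (vector [v $ src N k, v $ dst N k])"
      by (simp add: vec_eq_iff forall_2 Xi_nth W_def outer_def idx_def) blast
    then show ?thesis by (simp add: psd_outer)
  qed
  have "\<exists>u t. (u, t) \<in> perturbed N c \<and> (\<forall>i\<in>coords N. u i = w i)"
    if w: "\<forall>i\<in>coords N. \<bar>w i\<bar> \<le> e" for w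
  proof -
    have wA: "\<bar>w (Active n)\<bar> \<le> e" "\<bar>w (Reactive n)\<bar> \<le> e"
      and wX: "\<bar>w (Diag1 k)\<bar> \<le> e" "\<bar>w (Diag2 k)\<bar> \<le> e" "\<bar>w (OffRe k)\<bar> \<le> e" "\<bar>w (OffIm k)\<bar> \<le> e" for n k
      using w by (simp_all add: coords_def)
    have wI: "\<bar>w (Ineq m)\<bar> \<le> e" if "m \<in> constrs N" for m
      using w that by (simp add: coords_def)
    \<comment> \<open>The net injection that the perturbed balances prescribe. Being close to
      \<open>g n - d n\<close>, it splits into admissible generation and load.\<close>
    define x :: "'v \<Rightarrow> real^2" where
      "x n = vector [rtr (P_mat N n) V + dc_dot N (h_vec N n) p - w (Active n), rtr (Q_mat N n) V - w (Reactive n)]" for n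
    have "x n \<in> ball (g n - d n) (\<rho> n)" for n
    proof -
      have bal: "rtr (P_mat N n) (outer v) + dc_dot N (h_vec N n) p = (g n - d n) $ 1"
        "rtr (Q_mat N n) (outer v) = (g n - d n) $ 2"
        using opf by (auto simp: opf_feasible_def power_balance_def)
      have diff: "(x n - (g n - d n)) $ 1 = \<delta> * rtr (P_mat N n) ?one - w (Active n)"
        "(x n - (g n - d n)) $ 2 = \<delta> * rtr (Q_mat N n) ?one - w (Reactive n)"
        using bal by (simp_all add: x_def rtrV[OF PQ(1)] rtrV[OF PQ(2)])
      have "norm (x n - (g n - d n)) \<le> (\<Sum>i\<in>UNIV. \<bar>(x n - (g n - d n)) $ i\<bar>)"
        using norm_le_l1_cart by blast
      also have "\<dots> = \<bar>\<delta> * rtr (P_mat N n) ?one - w (Active n)\<bar> + \<bar>\<delta> * rtr (Q_mat N n) ?one - w (Reactive n)\<bar>"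
        by (simp only: sum_2 diff)
      also have "\<dots> \<le> (\<bar>\<delta> * rtr (P_mat N n) ?one\<bar> + e) + (\<bar>\<delta> * rtr (Q_mat N n) ?one\<bar> + e)"
        using wA[of n] by linarith
      also have "\<dots> = \<delta> * (\<bar>rtr (P_mat N n) ?one\<bar> + \<bar>rtr (Q_mat N n) ?one\<bar>) + 2 * e"
        using \<open>\<delta> > 0\<close> by (simp add: abs_mult algebra_simps)
      also have "\<dots> \<le> \<delta> * K + 2 * e"
        using \<open>\<delta> > 0\<close> KP[of n] by (simp add: mult_left_mono)
      also have "\<dots> < \<rho> n" using small r(1)[of n] by linarith
      finally show ?thesis by (simp add: dist_norm norm_minus_commute)
    qed
    then have "\<exists>a b. x n = a - b \<and> a \<in> gen N n \<and> b \<in> load N n" for n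
      using \<rho>(2)[of n] unfolding X_def by blast
    then obtain g' d' where gd: "\<And>n. x n = g' n - d' n" "\<And>n. g' n \<in> gen N n" "\<And>n. d' n \<in> load N n"
      by metis
    have "(w, welfare N g' d' - c) \<in> perturbed N c"
    proof (rule perturbedI[OF V])
      show "(g', d') \<in> injections N" using gd by (simp add: injections_def)
      fix n
      show "w (Active n) = rtr (P_mat N n) V + dc_dot N (h_vec N n) p - (g' n - d' n) $ 1"
        "w (Reactive n) = rtr (Q_mat N n) V - (g' n - d' n) $ 2"
        unfolding gd(1)[symmetric] x_def by simp_all
    next
      fix m assume m: "m \<in> constrs N"
      have "constr_lhs N V p m - b_val N m = \<delta> * rtr (C_mat N m) ?one - gap m"
        by (simp add: constr_lhs_def gap_def rtrV[OF C_mat_herm_sparse[OF N]])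
      also have "\<delta> * rtr (C_mat N m) ?one \<le> \<delta> * K"
        using KC[OF m] \<open>\<delta> > 0\<close> by (intro mult_left_mono) auto
      finally show "constr_lhs N V p m - b_val N m \<le> w (Ineq m)"
        using small r(2)[OF m] wI[OF m] \<open>e > 0\<close> by linarith
    next
      fix k
      let ?B = "\<delta> *\<^sub>R Xi N k ?one + block w k"
      have "src N k \<noteq> dst N k" using N by (simp add: hybrid_grid_def is_tree_def)
      then have B: "Re (?B $ 1 $ 1) = \<delta> + w (Diag1 k)" "Re (?B $ 2 $ 2) = \<delta> + w (Diag2 k)"
        "?B $ 1 $ 2 = Complex (w (OffRe k)) (w (OffIm k))"
        by (simp_all add: Xi_nth mat_def block_def)
      have "(cmod (?B $ 1 $ 2))\<^sup>2 \<le> e\<^sup>2 + e\<^sup>2"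
        unfolding B cmod_power2 complex.sel using wX[of k]
        by (intro add_mono power2_le_iff_abs_le[THEN iffD2]) auto
      also have "\<dots> \<le> (3 * e) * (3 * e)" by (simp add: power2_eq_square)
      also have "\<dots> \<le> (\<delta> + w (Diag1 k)) * (\<delta> + w (Diag2 k))"
        using wX[of k] \<open>e > 0\<close> by (intro mult_mono) (auto simp: e_def)
      finally have "psd_minors ?B"
        unfolding psd_minors_def B(1,2) using wX[of k] \<open>e > 0\<close> by (auto simp: e_def)
      moreover have "hermitian ?B"
        using one by (intro hermitian_add hermitian_scaleR hermitian_block hermitian_Xi) (simp add: herm_sparse_def)
      ultimately have "psd (Xi N k W + ?B)" by (simp add: psd_add XiW psd_2_iff[of ?B])
      then show "psd (Xi N k V + block w k)"
        by (simp add: V_def Xi_add Xi_scaleR add.assoc)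
    qed simp
    then show ?thesis by blast
  qed
  with \<open>e > 0\<close> show ?thesis by blast
qed

section \<open>Dual solutions\<close>

lemma nonneg_if_bounded_below_ray:
  fixes x C :: real
  assumes "\<And>r. 0 \<le> r \<Longrightarrow> C \<le> r * x"
  shows "0 \<le> x"
proof (rule ccontr)
  assume "\<not> 0 \<le> x"
  then have "0 \<le> (\<bar>C\<bar> + 1) / - x" "(\<bar>C\<bar> + 1) / - x * x = - (\<bar>C\<bar> + 1)"
    by (simp_all add: field_simps)
  with assms[of "(\<bar>C\<bar> + 1) / - x"] show False by linarith
qed

lemma zero_if_bounded_below_line:
  fixes x C :: real
  assumes "\<And>r. C \<le> r * x"
  shows "x = 0"
  using nonneg_if_bounded_below_ray[of C x] nonneg_if_bounded_below_ray[of C "- x"]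
    assms assms[of "- _"] by fastforce

lemma injections_nonempty:
  assumes "hybrid_grid N"
  shows "\<exists>g d. (g, d) \<in> injections N"
proof -
  have "gen N n \<noteq> {}" "load N n \<noteq> {}" for n
    using assms by (auto simp: hybrid_grid_def)
  then have "(\<lambda>n. SOME x. x \<in> gen N n, \<lambda>n. SOME x. x \<in> load N n) \<in> injections N"
    by (simp add: injections_def some_in_eq)
  then show ?thesis by blast
qed

lemma S_mat_sum_rtr:
  "rtr (\<Sum>k\<in>UNIV. S_mat N k ** Lam k ** transpose (S_mat N k)) V = (\<Sum>k\<in>UNIV. rtr (Lam k) (Xi N k V))"
  by (simp add: rtr_sum_left rtr_S_mat)

text \<open>Letting \<open>V\<close>, \<open>p\<close> and the slacks \<open>s\<close>, \<open>Y\<close> go to infinity separately in this inequality gives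
  the constraints of the dual.\<close>

lemma perturbed_multipliers:
  fixes N :: "('v::finite, 'e::finite) grid"
  assumes N: "hybrid_grid N" and "strictly_feasible N"
    and opt: "\<And>V p g d. soc_feasible N V p g d \<Longrightarrow> welfare N g d \<le> c"
  obtains lam mu and Lam :: "'e \<Rightarrow> complex^2^2" where "\<And>k. hermitian (Lam k)"
    "\<And>V p g d s Y. V \<in> herm_sparse N \<Longrightarrow> (g, d) \<in> injections N \<Longrightarrow>
      (\<And>m. m \<in> constrs N \<Longrightarrow> 0 \<le> s m) \<Longrightarrow> (\<And>k. psd (Y k)) \<Longrightarrow>
      welfare N g d - c \<le>
        rtr (Psi N lam mu - (\<Sum>k\<in>UNIV. S_mat N k ** Lam k ** transpose (S_mat N k))) V
        + dc_dot N (psi N lam mu) p - (\<Sum>n\<in>UNIV. lam n \<bullet> (g n - d n))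
        + (\<Sum>m\<in>constrs N. mu m * (s m - b_val N m)) + (\<Sum>k\<in>UNIV. rtr (Lam k) (Y k))"
proof -
  obtain e where "e > 0" and e: "\<And>w. (\<forall>i\<in>coords N. \<bar>w i\<bar> \<le> e) \<Longrightarrow>
      (\<exists>u t. (u, t) \<in> perturbed N c \<and> (\<forall>i\<in>coords N. u i = w i))"
    using perturbed_interior[OF assms(1,2), of c] by blast
  have "\<exists>y. \<forall>(u, t)\<in>perturbed N c. t \<le> (\<Sum>i\<in>coords N. y i * u i)"
    by (rule supporting_slopes[OF finite_coords perturbed_convex[OF N] perturbed_nonpos \<open>e > 0\<close> e])
      (auto intro: opt)
  then obtain y where y: "\<And>u t. (u, t) \<in> perturbed N c \<Longrightarrow> t \<le> (\<Sum>i\<in>coords N. y i * u i)"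
    by blast
  define lam :: "'v \<Rightarrow> real^2" where "lam n = vector [y (Active n), y (Reactive n)]" for n
  define mu where "mu m = y (Ineq m)" for m
  define Lam where "Lam = multiplier_block y"
  show thesis
  proof (rule that)
    show "hermitian (Lam k)" for k
      by (simp add: Lam_def multiplier_block_def hermitian_block)
  next
    fix V p g d s and Y :: "'e \<Rightarrow> complex^2^2"
    assume V: "V \<in> herm_sparse N" and gd: "(g, d) \<in> injections N"
      and s: "\<And>m. m \<in> constrs N \<Longrightarrow> 0 \<le> (s m :: real)" and Y: "\<And>k. psd (Y k)"
    \<comment> \<open>The block perturbation that turns \<open>Xi N k V\<close> into the prescribed
      psd matrix \<open>Y k\<close>.\<close>
    define Z where "Z k = Y k - Xi N k V" for k
    have hZ: "hermitian (Z k)" for k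
    proof -
      have "hermitian (Y k)" using Y by (simp add: psd_iff_outer)
      moreover have "hermitian (Xi N k V)" using V by (simp add: herm_sparse_def hermitian_Xi)
      ultimately show ?thesis
        using hermitian_add[of "Y k" "(-1) *\<^sub>R Xi N k V"] hermitian_scaleR[of "Xi N k V" "-1"] by (simp add: Z_def)
    qed
    define u where "u i = (case i of
        Active n \<Rightarrow> rtr (P_mat N n) V + dc_dot N (h_vec N n) p - (g n - d n) $ 1
      | Reactive n \<Rightarrow> rtr (Q_mat N n) V - (g n - d n) $ 2
      | Ineq m \<Rightarrow> constr_lhs N V p m - b_val N m + s m
      | Diag1 k \<Rightarrow> Re (Z k $ 1 $ 1) | Diag2 k \<Rightarrow> Re (Z k $ 2 $ 2)
      | OffRe k \<Rightarrow> Re (Z k $ 1 $ 2) | OffIm k \<Rightarrow> Im (Z k $ 1 $ 2))" for i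
    have block: "block u k = Z k" for k
      by (rule block_eqI[OF hZ]) (simp_all add: u_def)
    have "(u, welfare N g d - c) \<in> perturbed N c"
    proof (rule perturbedI[OF V gd])
      show "psd (Xi N k V + block u k)" for k
        using Y by (simp add: block Z_def)
    qed (use s in \<open>auto simp: u_def\<close>)
    then have "welfare N g d - c \<le> (\<Sum>i\<in>coords N. y i * u i)" by (rule y)
    also have "\<dots> = (\<Sum>n\<in>UNIV. y (Active n) * u (Active n) + y (Reactive n) * u (Reactive n)) +
        (\<Sum>m\<in>constrs N. mu m * u (Ineq m)) + (\<Sum>k\<in>UNIV. rtr (Lam k) (Z k))"
      by (simp add: sum_coords mu_def Lam_def rtr_multiplier_block flip: block)
    also have "(\<Sum>n\<in>UNIV. y (Active n) * u (Active n) + y (Reactive n) * u (Reactive n)) =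
        (\<Sum>n\<in>UNIV. lam n $ 1 * (rtr (P_mat N n) V + dc_dot N (h_vec N n) p) + lam n $ 2 * rtr (Q_mat N n) V)
        - (\<Sum>n\<in>UNIV. lam n \<bullet> (g n - d n))"
      unfolding sum_subtractf[symmetric]
      by (intro sum.cong refl) (simp add: u_def lam_def inner_vec_def sum_2 algebra_simps)
    also have "(\<Sum>m\<in>constrs N. mu m * u (Ineq m)) =
        (\<Sum>m\<in>constrs N. mu m * constr_lhs N V p m) + (\<Sum>m\<in>constrs N. mu m * (s m - b_val N m))"
      unfolding sum.distrib[symmetric] by (intro sum.cong refl) (simp add: u_def algebra_simps)
    also have "(\<Sum>k\<in>UNIV. rtr (Lam k) (Z k)) =
        (\<Sum>k\<in>UNIV. rtr (Lam k) (Y k)) - (\<Sum>k\<in>UNIV. rtr (Lam k) (Xi N k V))"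
    proof -
      have "rtr (Lam k) (Z k) + rtr (Lam k) (Xi N k V) = rtr (Lam k) (Y k)" for k
        by (simp add: Z_def flip: rtr_add_right)
      then show ?thesis by (simp add: eq_diff_eq flip: sum.distrib)
    qed
    also have "(\<Sum>k\<in>UNIV. rtr (Lam k) (Xi N k V)) =
        rtr (\<Sum>k\<in>UNIV. S_mat N k ** Lam k ** transpose (S_mat N k)) V"
      by (simp add: S_mat_sum_rtr)
    finally show "welfare N g d - c \<le>
        rtr (Psi N lam mu - (\<Sum>k\<in>UNIV. S_mat N k ** Lam k ** transpose (S_mat N k))) V
        + dc_dot N (psi N lam mu) p - (\<Sum>n\<in>UNIV. lam n \<bullet> (g n - d n))
        + (\<Sum>m\<in>constrs N. mu m * (s m - b_val N m)) + (\<Sum>k\<in>UNIV. rtr (Lam k) (Y k))"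
      using lagrangian_eq[of lam N V p mu]
        rtr_add_left[of "Psi N lam mu" "- (\<Sum>k\<in>UNIV. S_mat N k ** Lam k ** transpose (S_mat N k))" V]
      by (simp add: rtr_minus_left)
  qed
qed

text \<open>Once the unbounded directions have forced dual feasibility, the inequality for
  \<open>V = 0\<close> with zero flows and slacks involves only \<open>g\<close> and
  \<open>d\<close>, and the suprema can be taken bus by bus. Their boundedness is exported because
  later estimates against \<open>sigma\<close> and \<open>ppi\<close> depend on it.\<close>

lemma strong_duality:
  fixes N :: "('v::finite, 'e::finite) grid"
  assumes N: "hybrid_grid N" and "strictly_feasible N"
    and opt: "\<And>V p g d. soc_feasible N V p g d \<Longrightarrow> welfare N g d \<le> c"
  obtains lam mu and Lam :: "'e \<Rightarrow> complex^2^2" where "dual_feasible N lam mu Lam" "dual_value N lam mu \<le> c"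
    "\<And>n. bdd_above ((\<lambda>d. benefit N n d - lam n \<bullet> d) ` load N n)"
    "\<And>n. bdd_above ((\<lambda>g. lam n \<bullet> g - cost N n g) ` gen N n)"
proof (rule perturbed_multipliers[OF assms(1,2)])
  fix lam mu and Lam :: "'e \<Rightarrow> complex^2^2"
  assume hL: "\<And>k. hermitian (Lam k)"
    and key: "\<And>V p g d s Y. V \<in> herm_sparse N \<Longrightarrow> (g, d) \<in> injections N \<Longrightarrow>
      (\<And>m. m \<in> constrs N \<Longrightarrow> 0 \<le> s m) \<Longrightarrow> (\<And>k. psd (Y k)) \<Longrightarrow>
      welfare N g d - c \<le>
        rtr (Psi N lam mu - (\<Sum>k\<in>UNIV. S_mat N k ** Lam k ** transpose (S_mat N k))) V
        + dc_dot N (psi N lam mu) p - (\<Sum>n\<in>UNIV. lam n \<bullet> (g n - d n))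
        + (\<Sum>m\<in>constrs N. mu m * (s m - b_val N m)) + (\<Sum>k\<in>UNIV. rtr (Lam k) (Y k))"
  obtain g d where gd: "(g, d) \<in> injections N" using injections_nonempty[OF N] by blast
  define D where "D = Psi N lam mu - (\<Sum>k\<in>UNIV. S_mat N k ** Lam k ** transpose (S_mat N k))"
  define C where "C = welfare N g d - c + (\<Sum>n\<in>UNIV. lam n \<bullet> (g n - d n)) + (\<Sum>m\<in>constrs N. mu m * b_val N m)"
  have psd_0: "psd (0 :: complex^2^2)" by (simp add: psd_iff_outer hermitian_def)
  have C: "C \<le> rtr D V + dc_dot N (psi N lam mu) p + (\<Sum>m\<in>constrs N. mu m * s m) + (\<Sum>k\<in>UNIV. rtr (Lam k) (Y k))"
    if "V \<in> herm_sparse N" "\<And>m. m \<in> constrs N \<Longrightarrow> 0 \<le> s m" "\<And>k. psd (Y k)" for V p s Y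
    using key[where V = V and p = p and s = s and Y = Y, OF that(1) gd that(2,3)]
    by (simp add: C_def D_def right_diff_distrib sum_subtractf)
  have mu: "0 \<le> mu m" if "m \<in> constrs N" for m
  proof (rule nonneg_if_bounded_below_ray)
    fix r :: real assume "0 \<le> r"
    have "(\<Sum>m'\<in>constrs N. mu m' * (if m' = m then r else 0)) = r * mu m"
      using that finite_constrs[of N] by (simp add: if_distrib sum.delta cong: if_cong)
    with C[where V = 0 and s = "\<lambda>m'. if m' = m then r else 0" and Y = "\<lambda>_. 0" and p = "\<lambda>_. 0"] \<open>0 \<le> r\<close>
    show "C \<le> r * mu m"
      by (simp add: herm_sparse_0 psd_0 dc_dot_def)
  qed
  have Lam: "psd (Lam k)" for k
    unfolding psd_iff_outer
  proof (intro conjI allI hL nonneg_if_bounded_below_ray)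
    fix x and r :: real assume "0 \<le> r"
    have "(\<Sum>k'\<in>UNIV. rtr (Lam k') (if k' = k then r *\<^sub>R outer x else 0)) = r * rtr (Lam k) (outer x)"
      by (simp add: if_distrib[of "rtr _"] rtr_scaleR_right sum.delta cong: if_cong)
    with C[where V = 0 and s = "\<lambda>_. 0" and Y = "\<lambda>k'. if k' = k then r *\<^sub>R outer x else 0" and p = "\<lambda>_. 0"] \<open>0 \<le> r\<close>
    show "C \<le> r * rtr (Lam k) (outer x)"
      by (simp add: herm_sparse_0 psd_0 psd_scaleR psd_outer dc_dot_def)
  qed
  have psi: "psi N lam mu l = 0" if "l \<in> {1..n_dc N}" for l
  proof (rule zero_if_bounded_below_line)
    fix r :: real
    have "dc_dot N (psi N lam mu) (\<lambda>l'. if l' = l then r else 0) = r * psi N lam mu l"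
      using that by (simp add: dc_dot_def if_distrib sum.delta cong: if_cong)
    with C[where V = 0 and s = "\<lambda>_. 0" and Y = "\<lambda>_. 0" and p = "\<lambda>l'. if l' = l then r else 0"]
    show "C \<le> r * psi N lam mu l"
      by (simp add: herm_sparse_0 psd_0)
  qed
  have D: "D \<in> herm_sparse N"
  proof -
    have "(\<Sum>k\<in>UNIV. S_mat N k ** Lam k ** transpose (S_mat N k)) \<in> herm_sparse N"
      by (intro herm_sparse_sum S_mat_conj_herm_sparse hL)
    from herm_sparse_add[OF Psi_herm_sparse[OF N] herm_sparse_minus[OF this]]
    show ?thesis by (simp add: D_def)
  qed
  \<comment> \<open>The residual \<open>D\<close> is itself an admissible direction for
    \<open>V\<close>, with either sign.\<close>
  have "rtr D D = 0"
  proof (rule zero_if_bounded_below_line)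
    fix r :: real
    from C[where s = "\<lambda>_. 0" and Y = "\<lambda>_. 0" and p = "\<lambda>_. 0", OF herm_sparse_scaleR[OF D, of r]]
    show "C \<le> r * rtr D D"
      by (simp add: psd_0 rtr_scaleR_right dc_dot_def)
  qed
  then have "D = 0" using D rtr_self_eq_0_iff by (auto simp: herm_sparse_def)
  then have "Psi N lam mu = (\<Sum>k\<in>UNIV. S_mat N k ** Lam k ** transpose (S_mat N k))"
    by (simp add: D_def)
  then have feas: "dual_feasible N lam mu Lam"
    unfolding dual_feasible_def using mu psi Lam by blast
  define c' where "c' = c - (\<Sum>m\<in>constrs N. mu m * b_val N m)"
  have sep: "(\<Sum>n\<in>UNIV. benefit N n (d n) - lam n \<bullet> d n) + (\<Sum>n\<in>UNIV. lam n \<bullet> g n - cost N n (g n)) \<le> c'"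
    if "\<And>n. g n \<in> gen N n" "\<And>n. d n \<in> load N n" for g d
  proof -
    have "(g, d) \<in> injections N" using that by (simp add: injections_def)
    from key[where p = "\<lambda>_. 0" and s = "\<lambda>_. 0" and Y = "\<lambda>_. 0", OF herm_sparse_0 this] show ?thesis
      by (simp add: psd_0 dc_dot_def welfare_def inner_diff_right sum_subtractf
          sum_negf c'_def)
  qed
  have ne: "gen N n \<noteq> {}" "load N n \<noteq> {}" for n
    using N by (auto simp: hybrid_grid_def)
  \<comment> \<open>The suprema over loads are taken for fixed generation, and those over generation
    against the resulting bound.\<close>
  have le_d: "(\<Sum>n\<in>UNIV. benefit N n (d n) - lam n \<bullet> d n) \<le> c' - (\<Sum>n\<in>UNIV. lam n \<bullet> g n - cost N n (g n))"
    if "\<And>n. g n \<in> gen N n" "\<And>n. d n \<in> load N n" for g d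
    using sep[OF that] by linarith
  have sup_d: "bdd_above ((\<lambda>d. benefit N n d - lam n \<bullet> d) ` load N n)"
    "(\<Sum>n\<in>UNIV. sigma N n (lam n)) \<le> c' - (\<Sum>n\<in>UNIV. lam n \<bullet> g n - cost N n (g n))"
    if "\<And>n. g n \<in> gen N n" for g n
    using sum_SUP_le[where A = "load N" and F = "\<lambda>n d. benefit N n d - lam n \<bullet> d", OF ne(2) le_d[OF that]]
    by (auto simp: sigma_def)
  have le_g: "(\<Sum>n\<in>UNIV. lam n \<bullet> g n - cost N n (g n)) \<le> c' - (\<Sum>n\<in>UNIV. sigma N n (lam n))"
    if "\<And>n. g n \<in> gen N n" for g
    using sup_d(2)[OF that] by linarith
  have sup_g: "bdd_above ((\<lambda>g. lam n \<bullet> g - cost N n g) ` gen N n)"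
    "(\<Sum>n\<in>UNIV. ppi N n (lam n)) \<le> c' - (\<Sum>n\<in>UNIV. sigma N n (lam n))" for n
    using sum_SUP_le[where A = "gen N" and F = "\<lambda>n g. lam n \<bullet> g - cost N n g", OF ne(1) le_g]
    by (auto simp: ppi_def)
  have gdn: "\<And>n. g n \<in> gen N n" using gd by (simp add: injections_def)
  show thesis
  proof (rule that[OF feas _ sup_d(1)[OF gdn] sup_g(1)])
    show "dual_value N lam mu \<le> c"
      using sup_g(2) by (simp add: dual_value_def c'_def)
  qed
qed (rule opt)

text \<open>Without a duality gap, weak duality has no room left: the trace products sum to at most
  0 over the branches, and each is nonnegative.\<close>

lemma complementary_slackness:
  fixes N :: "('v::finite, 'e::finite) grid"
  assumes N: "hybrid_grid N" and "strictly_feasible N"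
    and primal: "soc_optimal N V p g d" and dual: "dual_optimal N lam mu Lam"
  shows "rtr (Lam k) (Xi N k V) = 0"
proof -
  have feas: "soc_feasible N V p g d" and dfeas: "dual_feasible N lam mu Lam"
    using primal dual by (auto simp: soc_optimal_def dual_optimal_def)
  obtain lam' mu' and Lam' :: "'e \<Rightarrow> complex^2^2" where
    dfeas': "dual_feasible N lam' mu' Lam'" and val': "dual_value N lam' mu' \<le> welfare N g d"
    and bdd_d: "\<And>n. bdd_above ((\<lambda>d. benefit N n d - lam' n \<bullet> d) ` load N n)"
    and bdd_g: "\<And>n. bdd_above ((\<lambda>g. lam' n \<bullet> g - cost N n g) ` gen N n)"
    by (rule strong_duality[OF assms(1,2), of "welfare N g d"]) (use primal in \<open>auto simp: soc_optimal_def\<close>)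
  have val: "dual_value N lam mu \<le> welfare N g d"
    using dual dfeas' val' by (force simp: dual_optimal_def)
  \<comment> \<open>Boundedness is known for \<open>lam'\<close>, not yet for the given
    \<open>lam\<close>. The two objectives differ by a linear function, which is bounded on a
    compact set.\<close>
  have lin: "bdd_above ((\<lambda>x. f x + a \<bullet> x) ` A)"
    if A: "bdd_above (f ` A)" "compact A" for f and a :: "real^2" and A
  proof -
    obtain M where M: "\<And>x. x \<in> A \<Longrightarrow> f x \<le> M" using A(1) by (auto simp: bdd_above_def)
    obtain B where B: "\<And>x. x \<in> A \<Longrightarrow> norm x \<le> B"
      using compact_imp_bounded[OF A(2)] by (auto simp: bounded_iff)
    have "f x + a \<bullet> x \<le> M + norm a * B" if "x \<in> A" for x
    proof -
      have "a \<bullet> x \<le> norm a * norm x" by (rule norm_cauchy_schwarz)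
      also have "\<dots> \<le> norm a * B" using B[OF that] by (simp add: mult_left_mono)
      finally show ?thesis using M[OF that] by linarith
    qed
    then show ?thesis by (rule bdd_aboveI2)
  qed
  have cpt: "compact (gen N n)" "compact (load N n)" for n
    using N by (auto simp: hybrid_grid_def)
  have "bdd_above ((\<lambda>d. benefit N n d - lam n \<bullet> d) ` load N n)" for n
    using lin[OF bdd_d cpt(2), of n "lam' n - lam n"] by (simp add: inner_diff_left)
  moreover have "d n \<in> load N n" "g n \<in> gen N n" for n
    using feas by (auto simp: soc_feasible_def injections_def)
  ultimately have sig: "benefit N n (d n) - lam n \<bullet> d n \<le> sigma N n (lam n)" for n
    unfolding sigma_def by (meson cSUP_upper)
  have "bdd_above ((\<lambda>g. lam n \<bullet> g - cost N n g) ` gen N n)" for n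
    using lin[OF bdd_g cpt(1), of n "lam n - lam' n"] by (simp add: inner_diff_left algebra_simps)
  then have pi: "lam n \<bullet> g n - cost N n (g n) \<le> ppi N n (lam n)" for n
    unfolding ppi_def using \<open>\<And>n. g n \<in> gen N n\<close> by (meson cSUP_upper)
  have "(\<Sum>n\<in>UNIV. benefit N n (d n) - lam n \<bullet> d n) \<le> (\<Sum>n\<in>UNIV. sigma N n (lam n))"
    "(\<Sum>n\<in>UNIV. lam n \<bullet> g n - cost N n (g n)) \<le> (\<Sum>n\<in>UNIV. ppi N n (lam n))"
    by (intro sum_mono sig pi)+
  then have 1: "(\<Sum>n\<in>UNIV. lam n \<bullet> (g n - d n)) + (\<Sum>m\<in>constrs N. mu m * b_val N m) \<le> 0"
    using val by (simp add: dual_value_def welfare_def sum_subtractf inner_diff_right)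
  have 2: "(\<Sum>m\<in>constrs N. mu m * constr_lhs N V p m) \<le> (\<Sum>m\<in>constrs N. mu m * b_val N m)"
    using feas dfeas by (intro sum_mono mult_left_mono) (auto simp: soc_feasible_def dual_feasible_def)
  have "(\<Sum>n\<in>UNIV. lam n \<bullet> (g n - d n)) = (\<Sum>n\<in>UNIV.
      lam n $ 1 * (rtr (P_mat N n) V + dc_dot N (h_vec N n) p) + lam n $ 2 * rtr (Q_mat N n) V)"
    using feas by (simp add: soc_feasible_def power_balance_def inner_vec_def sum_2)
  moreover have "dc_dot N (psi N lam mu) p = 0"
    using dfeas by (simp add: dc_dot_def dual_feasible_def)
  moreover have "rtr (Psi N lam mu) V = (\<Sum>k\<in>UNIV. rtr (Lam k) (Xi N k V))"
    using dfeas by (simp add: dual_feasible_def S_mat_sum_rtr)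
  ultimately have le: "(\<Sum>k\<in>UNIV. rtr (Lam k) (Xi N k V)) \<le> 0"
    using lagrangian_eq[of lam N V p mu] 1 2 by linarith
  have nn: "0 \<le> rtr (Lam k) (Xi N k V)" for k
    using feas dfeas by (intro rtr_2_nonneg) (auto simp: soc_feasible_def dual_feasible_def)
  then have "0 \<le> (\<Sum>k\<in>UNIV. rtr (Lam k) (Xi N k V))" by (simp add: sum_nonneg)
  with le have "(\<Sum>k\<in>UNIV. rtr (Lam k) (Xi N k V)) = 0" by linarith
  then show ?thesis using nn by (simp add: sum_nonneg_eq_0_iff)
qed

section \<open>From vanishing trace products to exactness\<close>

lemma S_mat_sum_edge:
  fixes N :: "('v::finite, 'e::finite) grid"
  assumes "is_tree (src N) (dst N)"
  shows "(\<Sum>k\<in>UNIV. S_mat N k ** Lam k ** transpose (S_mat N k)) $ src N k $ dst N k = Lam k $ 1 $ 2"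
proof -
  have ne: "src N k \<noteq> dst N k" for k
    using assms by (simp add: is_tree_def)
  have inj: "inj (\<lambda>k. {src N k, dst N k})"
    using assms by (simp add: is_tree_def)
  have "(S_mat N k' ** Lam k' ** transpose (S_mat N k')) $ src N k $ dst N k
      = (if k' = k then Lam k $ 1 $ 2 else 0)" for k'
  proof (cases "k' = k")
    case True
    then show ?thesis using ne[of k] by (simp add: S_mat_conj_nth S_mat_nth sum_2)
  next
    case False
    then have "{src N k', dst N k'} \<noteq> {src N k, dst N k}"
      using inj by (meson injD)
    \<comment> \<open>If both were nonzero, the two distinct end points of \<open>k\<close> would be
      the end points of \<open>k'\<close>.\<close>
    then have "S_mat N k' $ src N k $ a = 0 \<or> S_mat N k' $ dst N k $ b = 0" for a b
      using ne[of k] by (auto simp: S_mat_nth)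
    then show ?thesis
      using False unfolding S_mat_conj_nth
      by (simp, intro sum.neutral ballI) (metis mult_eq_0_iff)
  qed
  then show ?thesis by (simp add: sum_component)
qed

lemma voltage_pos:
  assumes "hybrid_grid N" "soc_feasible N V p g d"
  shows "0 < Re (V $ n $ n)"
proof -
  have "rtr (unit_mat n) V = Re (V $ n $ n)"
  proof -
    have "rtr (unit_mat n) V = (\<Sum>i\<in>UNIV. \<Sum>j\<in>UNIV. if j = n then if i = n then Re (V $ n $ n) else 0 else 0)"
      unfolding rtr_eq by (intro sum.cong refl) (simp add: unit_mat_nth)
    then show ?thesis by simp
  qed
  moreover have "V_Lo n \<in> constrs N" by (simp add: constrs_def)
  then have "constr_lhs N V p (V_Lo n) \<le> b_val N (V_Lo n)"
    using assms(2) unfolding soc_feasible_def by blast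
  ultimately have "(V_lo N n)\<^sup>2 \<le> Re (V $ n $ n)"
    by (simp add: constr_lhs_def dc_dot_def rtr_minus_left)
  moreover have "0 < (V_lo N n)\<^sup>2"
    using assms(1) by (simp add: hybrid_grid_def less_imp_neq[symmetric])
  ultimately show ?thesis by linarith
qed

theorem corollary2:
  fixes N :: "('v::finite, 'e::finite) grid"
    and V :: "complex^'v^'v" and p :: "nat \<Rightarrow> real" and g d :: "'v \<Rightarrow> real^2"
    and lam :: "'v \<Rightarrow> real^2" and mu :: "('v, 'e) constr \<Rightarrow> real" and Lam :: "'e \<Rightarrow> complex^2^2"
  assumes "hybrid_grid N"
    and "strictly_feasible N"
    and "soc_optimal N V p g d"
    and "dual_optimal N lam mu Lam"
    and "(lam, mu) \<notin> (\<Union>k. pathological N k)"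
  shows "(\<forall>k. rank (Xi N k V) = 1) \<and> soc_exact N"
proof -
  have feas: "soc_feasible N V p g d" and dfeas: "dual_feasible N lam mu Lam"
    using assms(3,4) by (auto simp: soc_optimal_def dual_optimal_def)
  have tree: "is_tree (src N) (dst N)" using assms(1) by (simp add: hybrid_grid_def)
  have herm: "hermitian V" using feas by (simp add: soc_feasible_def herm_sparse_def)
  have pos: "0 < Re (V $ n $ n)" for n by (rule voltage_pos[OF assms(1) feas])
  have det: "(cmod (Xi N k V $ 1 $ 2))\<^sup>2 = Re (Xi N k V $ 1 $ 1) * Re (Xi N k V $ 2 $ 2)" for k
  proof (rule complementary_2)
    show "psd (Lam k)" using dfeas by (simp add: dual_feasible_def)
    show "psd (Xi N k V)" using feas by (simp add: soc_feasible_def)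
    show "rtr (Lam k) (Xi N k V) = 0" by (rule complementary_slackness[OF assms(1-4)])
    have "Psi N lam mu $ src N k $ dst N k = Lam k $ 1 $ 2"
      using dfeas S_mat_sum_edge[OF tree] by (simp add: dual_feasible_def)
    then show "Lam k $ 1 $ 2 \<noteq> 0" using assms(5) by (auto simp: pathological_def)
  qed
  have rank: "rank (Xi N k V) = 1" for k
    by (rule rank_1_2[OF hermitian_Xi[OF herm] _ det]) (simp add: Xi_nth pos)
  obtain v where v: "\<forall>n. v $ n * cnj (v $ n) = V $ n $ n"
    "\<forall>(i, j)\<in>adjacent (src N) (dst N). v $ i * cnj (v $ j) = V $ i $ j"
    using tree_factorization[OF tree herm pos] det by (auto simp: Xi_nth)
  have "rank1_completable N V"
    unfolding rank1_completable_def
  proof (intro exI[of _ "outer v"] conjI)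
    have "v \<noteq> 0" using v(1) pos[of undefined] by (metis less_irrefl mult_zero_left zero_complex.sel(1) zero_index)
    then show "rank (outer v) = 1" by (rule rank_outer)
    \<comment> \<open>The completion has to match only diagonal and branch entries, which the
      factorization supplies.\<close>
    have "i = j \<or> (i, j) \<in> adjacent (src N) (dst N)" if "(i, j) \<in> idx N" for i j
      using that unfolding idx_def adjacent_def by auto
    then show "\<forall>(i, j)\<in>idx N. outer v $ i $ j = V $ i $ j"
      using v by (fastforce simp: outer_def)
  qed (rule psd_outer)
  with rank assms(3) show ?thesis unfolding soc_exact_def by blast
qed

end
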